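(* Let $v, w$ be two different binary words with $|v| = |w|$ and $|v|_1 \ge |w|_1$. Assume that $$\mathcal{B}(v,v)\setminus\{v\} = \mathcal{B}(w,w)\setminus\{w\}.$$ Then: (1) There exists a length-preserving bijection $\kappa_{v,w} : \Omega^w \to \Omega^v$ such that $|\omega|_1 \ge |\kappa_{v,w}(\omega)|_1$ for all $\omega \in \Omega^w$. (2) If in addition $$\mathcal{B}(v,v)\setminus\{v\} = \mathcal{B}(w,w)\setminus\{w\} = \mathcal{B}(v,w) = \mathcal{B}(w,v),$$ then there exists a length-preserving bijection $\psi_{v,w} : \Omega^w \to \Omega^v$ such that $|\omega|_1 \ge |\psi_{v,w}(\omega)|_1$ for all $\omega \in \Omega^w$ and such that $\psi_{v,w}$ has bounded coding radius. (3) In either case, $\rho^v \le \rho^w$. Moreover, if $|v|_1 > |w|_1$, then $\rho^v < \rho^w$.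
   Context: A word is an element of $\{0,1\}^k$ for some integer $k \ge 1$. For a word $\omega$, $|\omega|$ is its length, $|\omega|_1$ its number of $1$s, and $\omega_{[a,b]} = (\omega_a,\dots,\omega_b)$. A factor of $\omega$ is a contiguous subword $\omega_{[a,b]}$. For a word $w$ and $n \ge 1$, $\Omega_n^w$ is the set of words in $\{0,1\}^n$ that do not contain $w$ as a factor, and $\Omega^w = \bigcup_{n\ge 1}\Omega_n^w$. A map $\Omega^w\to\Omega^v$ is length-preserving if it maps $\Omega_n^w$ into $\Omega_n^v$ for every $n$. Borders: for words $v,w$ with $|v|=k$, $\mathcal{B}(v,w)=\{w_{[1,j]} : j\in\{1,\dots,|w|\},\ w_{[1,j]} = v_{[k-j+1,k]}\}$, i.e. the set of non-empty prefixes of $w$ that are suffixes of $v$. In particular $w\in\mathcal{B}(w,w)$. Bounded coding radius: a length-preserving map $\psi:\Omega^w\to\Omega^v$ has bounded coding radius if there is an $R$ (depending only on $v,w$) such that for every $n$, $\omega\in\Omega_n^w$ and $i\in\{1,\dots,n\}$, the digit $\psi(\omega)_i$ is determined, by a fixed function not depending on $i$, by the digits of $\omega$ at indices in $[i-R,i+R]$ (those that lie in $\{1,\dots,n\}$). Letter frequency: $\rho_n^w = \frac{1}{n|\Omega_n^w|}\sum_{\omega\in\Omega_n^w} |\omega|_1$ and $\rho^w = \lim_{n\to\infty}\rho_n^w$ (this limit always exists). *)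

theory Defs
  imports Complex_Main "HOL-Library.Sublist"
begin

text \<open>
  Binary words are non-empty lists of type \<open>bool list\<close>, with \<open>True\<close> for the digit 1 and \<open>False\<close>
  for the digit 0. Lists are indexed from 0.
\<close>

definition ones :: "bool list \<Rightarrow> nat" where
  "ones \<omega> = count_list \<omega> True"

definition Omega_n :: "bool list \<Rightarrow> nat \<Rightarrow> bool list set" where
  "Omega_n w n = {\<omega>. length \<omega> = n \<and> \<not> sublist w \<omega>}"

definition Omega :: "bool list \<Rightarrow> bool list set" where
  "Omega w = (\<Union>n\<in>{1..}. Omega_n w n)"

definition borders :: "bool list \<Rightarrow> bool list \<Rightarrow> bool list set" where
  "borders v w = {u. u \<noteq> [] \<and> prefix u w \<and> suffix u v}"

definition length_preserving ::
  "bool list \<Rightarrow> bool list \<Rightarrow> (bool list \<Rightarrow> bool list) \<Rightarrow> bool" where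
  "length_preserving w v \<psi> \<longleftrightarrow> (\<forall>n\<ge>1. \<psi> ` Omega_n w n \<subseteq> Omega_n v n)"

text \<open>
  The part of \<open>\<omega>\<close> seen from position \<open>i\<close> with radius \<open>R\<close>, as a function of the relative offset
  \<open>j\<close>; the value is \<open>None\<close> at offsets beyond the radius or outside the word. A local rule that
  reads it is thus independent of \<open>i\<close>, but sees the ends of the word when they are within distance
  \<open>R\<close>.
\<close>

definition window :: "nat \<Rightarrow> bool list \<Rightarrow> nat \<Rightarrow> int \<Rightarrow> bool option" where
  "window R \<omega> i j =
     (if \<bar>j\<bar> \<le> int R \<and> 0 \<le> int i + j \<and> int i + j < int (length \<omega>)
      then Some (\<omega> ! nat (int i + j)) else None)"

definition bounded_coding_radius :: "bool list \<Rightarrow> (bool list \<Rightarrow> bool list) \<Rightarrow> bool" where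
  "bounded_coding_radius w \<psi> \<longleftrightarrow>
     (\<exists>(R :: nat) (f :: (int \<Rightarrow> bool option) \<Rightarrow> bool).
        \<forall>n\<ge>1. \<forall>\<omega>\<in>Omega_n w n. \<forall>i<n. \<psi> \<omega> ! i = f (window R \<omega> i))"

definition rho_n :: "bool list \<Rightarrow> nat \<Rightarrow> real" where
  "rho_n w n = (\<Sum>\<omega>\<in>Omega_n w n. real (ones \<omega>)) / (real n * real (card (Omega_n w n)))"

definition rho :: "bool list \<Rightarrow> real" where
  "rho w = lim (rho_n w)"

end

theory Submission
  imports Defs "HOL-Analysis.Analysis"
begin

text \<open>
  Weight a word \<open>\<omega>\<close> by \<open>z ^ length \<omega> * y ^ ones \<omega>\<close>. Appending a letter, respectively all of
  \<open>v\<close>, to a word that avoids \<open>v\<close> gives \<open>F = c / Q\<close> for the generating function \<open>F\<close> of the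
  \<open>v\<close>-avoiding words, where \<open>c\<close> is the autocorrelation polynomial of \<open>v\<close> and
  \<open>Q = z^m y^k + (1 - z - z y) c\<close>, with \<open>m = length v\<close> and \<open>k = ones v\<close>; moreover \<open>1 / Q\<close> has
  non-negative coefficients, as it counts the words \<open>p\<close> such that \<open>p @ v\<close> contains \<open>v\<close> only at
  its end. If \<open>v\<close> and \<open>w\<close> have the same proper borders and \<open>ones v = ones w + d\<close>, then
  \<open>F\<^sub>v - F\<^sub>w = z^m y^(ones w) (1 - y^d) / (Q\<^sub>v Q\<^sub>w)\<close>. Divided by \<open>1 - y\<close> this still has
  non-negative coefficients: the number of ones in \<open>Omega_n w n\<close> stochastically dominates that in
  \<open>Omega_n v n\<close>, and a matching gives \<open>\<kappa>\<close>. Under the stronger hypothesis on the borders, replacing all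
  occurrences of \<open>v\<close> by \<open>w\<close> at once is well defined, local and inverted by the opposite
  replacement.

  For the frequencies, let \<open>r\<close> be the smallest positive zero of \<open>Q(\<cdot>, 1)\<close>. Because it is simple, the
  growth rate of the total weight of \<open>Omega_n v n\<close> is differentiable in \<open>ln y\<close> at \<open>y = 1\<close>, and its derivative
  \<open>Q_y / (r Q_z)\<close> at \<open>(r, 1)\<close> is \<open>rho v\<close>. Passing from \<open>w\<close> to \<open>v\<close> leaves \<open>r\<close> and \<open>Q_z < 0\<close>
  unchanged, while \<open>Q_y\<close> increases by \<open>d (2 r - 1) > 0\<close>.
\<close>

subsection \<open>Generating functions of avoiding words\<close>

lemma ones_append [simp]: "ones (xs @ ys) = ones xs + ones ys"
  by (simp add: ones_def)

lemma ones_simps [simp]: "ones [] = 0" "ones (b # xs) = of_bool b + ones xs"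
  by (auto simp: ones_def)

lemma finite_Omega_n [simp]: "finite (Omega_n w n)"
proof -
  have "Omega_n w n \<subseteq> {xs. set xs \<subseteq> UNIV \<and> length xs = n}"
    by (auto simp: Omega_n_def)
  then show ?thesis
    using finite_lists_length_eq[of "UNIV :: bool set" n] finite_subset by auto
qed

text \<open>For non-empty \<open>v\<close>, every occurrence of \<open>v\<close> in
  \<open>p @ v\<close> other than the final one lies in \<open>butlast (p @ v)\<close>; so
  \<open>v\<close> is completed for the first time exactly at the end.\<close>

definition first_occ :: "bool list \<Rightarrow> nat \<Rightarrow> bool list set" where
  "first_occ v n = {p. length p = n \<and> \<not> sublist v (butlast (p @ v))}"

lemma finite_first_occ [simp]: "finite (first_occ w n)"
proof -
  have "first_occ w n \<subseteq> {xs. set xs \<subseteq> UNIV \<and> length xs = n}"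
    by (auto simp: first_occ_def)
  then show ?thesis
    using finite_lists_length_eq[of "UNIV :: bool set" n] finite_subset by auto
qed

lemma sublist_butlast_or_suffix:
  assumes "sublist v xs"
  shows "sublist v (butlast xs) \<or> suffix v xs"
proof -
  obtain ps ss where xs: "xs = ps @ v @ ss"
    using assms by (auto simp: sublist_def)
  show ?thesis
  proof (cases "ss = []")
    case True
    then show ?thesis using xs by (simp add: suffix_def)
  next
    case False
    then have "butlast xs = ps @ v @ butlast ss"
      using xs by (simp add: butlast_append)
    then show ?thesis by (auto simp: sublist_def)
  qed
qed

lemma sublist_butlastD: "sublist v (butlast xs) \<Longrightarrow> sublist v xs"
  by (metis append_butlast_last_id butlast.simps(1) sublist_append)

text \<open>A word whose longest proper prefix avoids \<open>v\<close> can contain \<open>v\<close>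
  only as a suffix; this sorts all one-letter extensions of avoiding words.\<close>

lemma butlast_avoiding_eq:
  assumes "v \<noteq> []"
  shows "{xs. length xs = Suc n \<and> \<not> sublist v (butlast xs)} =
     Omega_n v (Suc n) \<union>
     (if length v \<le> Suc n then (\<lambda>p. p @ v) ` first_occ v (Suc n - length v) else {})"
    (is "?L = ?O \<union> ?F")
proof (intro equalityI subsetI)
  fix xs assume xs: "xs \<in> ?L"
  show "xs \<in> ?O \<union> ?F"
  proof (cases "sublist v xs")
    case True
    then obtain p where p: "xs = p @ v"
      using xs sublist_butlast_or_suffix by (auto simp: suffix_def)
    with xs have "p \<in> first_occ v (Suc n - length v)" "length v \<le> Suc n"
      by (auto simp: first_occ_def)
    then show ?thesis using p by auto
  qed (use xs in \<open>auto simp: Omega_n_def\<close>)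
next
  fix xs assume "xs \<in> ?O \<union> ?F"
  then show "xs \<in> ?L"
    by (auto simp: Omega_n_def first_occ_def split: if_splits dest: sublist_butlastD)
qed

text \<open>The ring of \<open>y\<close> stays arbitrary: \<open>1 :: int\<close> counts words,
  \<open>fps_X :: int fps\<close> keeps track of the number of ones, and real \<open>y\<close> gives
  the weighted sums behind the growth rates.\<close>

definition avoid_gf :: "bool list \<Rightarrow> 'a::comm_ring_1 \<Rightarrow> 'a fps" where
  "avoid_gf v y = Abs_fps (\<lambda>n. \<Sum>\<omega>\<in>Omega_n v n. y ^ ones \<omega>)"

definition first_gf :: "bool list \<Rightarrow> 'a::comm_ring_1 \<Rightarrow> 'a fps" where
  "first_gf v y = Abs_fps (\<lambda>n. \<Sum>p\<in>first_occ v n. y ^ ones p)"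

text \<open>A border \<open>u\<close> stands for a shift of \<open>v\<close> against itself by
  \<open>length v - length u\<close>, weighted by the ones in the prefix of \<open>v\<close> that is
  shifted over.\<close>

definition corr_gf :: "bool list \<Rightarrow> 'a::comm_ring_1 \<Rightarrow> 'a fps" where
  "corr_gf v y = (\<Sum>u\<in>borders v v. fps_X ^ (length v - length u) * fps_const (y ^ (ones v - ones u)))"

definition denom_gf :: "bool list \<Rightarrow> 'a::comm_ring_1 \<Rightarrow> 'a fps" where
  "denom_gf v y = fps_X ^ length v * fps_const (y ^ ones v)
     + (1 - fps_X * fps_const (1 + y)) * corr_gf v y"

lemma finite_borders [simp]: "finite (borders v w)"
  by (rule finite_subset[of _ "set (prefixes w)"]) (auto simp: borders_def)

text \<open>Appending a letter to an avoiding word gives either a non-empty avoiding word or a word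
  that ends in its first occurrence of \<open>v\<close>; the summand 1 accounts for the empty
  word.\<close>

lemma avoid_gf_step:
  fixes y :: "'a::comm_ring_1"
  assumes "v \<noteq> []"
  shows "1 + fps_X * fps_const (1 + y) * avoid_gf v y =
         avoid_gf v y + fps_X ^ length v * fps_const (y ^ ones v) * first_gf v y"
proof (rule fps_ext)
  fix n
  show "fps_nth (1 + fps_X * fps_const (1 + y) * avoid_gf v y) n =
        fps_nth (avoid_gf v y + fps_X ^ length v * fps_const (y ^ ones v) * first_gf v y) n"
  proof (cases n)
    case 0
    have "Omega_n v 0 = {[]}"
      using assms by (auto simp: Omega_n_def)
    then show ?thesis
      using 0 assms by (simp add: avoid_gf_def fps_X_power_mult_nth mult.assoc)
  next
    case (Suc n')
    let ?B = "{xs. length xs = Suc n' \<and> \<not> sublist v (butlast xs)}"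
    have "(\<Sum>xs\<in>?B. y ^ ones xs) = (\<Sum>(\<omega>, b)\<in>Omega_n v n' \<times> UNIV. y ^ ones (\<omega> @ [b]))"
    proof (rule sum.reindex_bij_witness[of _ "\<lambda>(\<omega>, b). \<omega> @ [b]" "\<lambda>xs. (butlast xs, last xs)"], goal_cases)
      case (1 a)
      then show ?case by (cases a rule: rev_cases) auto
    next
      case (2 a)
      then show ?case by (auto simp: Omega_n_def)
    next
      case (3 b)
      then show ?case by auto
    next
      case (4 b)
      then show ?case by (auto simp: Omega_n_def)
    next
      case (5 a)
      then show ?case by (cases a rule: rev_cases) auto
    qed
    also have "\<dots> = (1 + y) * (\<Sum>\<omega>\<in>Omega_n v n'. y ^ ones \<omega>)"
      by (subst sum.cartesian_product[symmetric])
         (simp add: UNIV_bool sum_distrib_left algebra_simps power_add)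
    finally have 1: "(\<Sum>xs\<in>?B. y ^ ones xs) = (1 + y) * (\<Sum>\<omega>\<in>Omega_n v n'. y ^ ones \<omega>)" .
    have "(\<Sum>xs\<in>?B. y ^ ones xs) = (\<Sum>xs\<in>Omega_n v (Suc n'). y ^ ones xs) +
      (\<Sum>xs\<in>(if length v \<le> Suc n' then (\<lambda>p. p @ v) ` first_occ v (Suc n' - length v) else {}).
         y ^ ones xs)"
      unfolding butlast_avoiding_eq[OF assms]
      by (rule sum.union_disjoint) (simp, simp, auto simp: Omega_n_def)
    also have "(\<Sum>xs\<in>(if length v \<le> Suc n' then (\<lambda>p. p @ v) ` first_occ v (Suc n' - length v) else {}).
         y ^ ones xs) = (if length v \<le> Suc n' then
         y ^ ones v * (\<Sum>p\<in>first_occ v (Suc n' - length v). y ^ ones p) else 0)"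
      by (simp add: sum.reindex inj_on_def sum_distrib_left power_add mult.commute)
    finally show ?thesis
      using 1 Suc by (simp add: avoid_gf_def first_gf_def fps_X_power_mult_nth mult.assoc not_less)
  qed
qed

lemma borders_selfD:
  assumes "u \<in> borders v v"
  shows "u \<noteq> []" "length u \<le> length v" "take (length u) v = u" "drop (length v - length u) v = u"
proof -
  show "u \<noteq> []" "length u \<le> length v" "take (length u) v = u" 
    using assms by (auto simp: borders_def prefix_def)
  show "drop (length v - length u) v = u"
    using assms by (auto simp: borders_def suffix_def)
qed

lemma ones_take_border:
  assumes "u \<in> borders v v"
  shows "ones (take (length v - length u) v) = ones v - ones u"
  by (metis append_take_drop_id assms borders_selfD(4) diff_add_inverse2 ones_append)

text \<open>Append the letters of \<open>v\<close> to an avoiding word until \<open>v\<close> first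
  occurs, after \<open>i\<close> letters. This occurrence is final, and its last \<open>i\<close>
  letters \<open>take i v\<close> form a border; cutting them off leaves \<open>p\<close> followed
  by the first \<open>length v - i\<close> letters of \<open>v\<close>.\<close>

lemma avoiding_eq_Union_first_occ:
  assumes "v \<noteq> []"
  shows "Omega_n v n = (\<Union>u\<in>{u\<in>borders v v. length v - length u \<le> n}.
     (\<lambda>p. p @ take (length v - length u) v) ` first_occ v (n - (length v - length u)))"
    (is "_ = ?U")
proof (intro equalityI subsetI)
  fix \<omega> assume \<omega>: "\<omega> \<in> Omega_n v n"
  define i where "i = (LEAST i. sublist v (\<omega> @ take i v))"
  have ex: "sublist v (\<omega> @ take (length v) v)" by (simp add: suffix_imp_sublist suffix_def)
  have i: "sublist v (\<omega> @ take i v)" and i_le: "i \<le> length v"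
    and i_least: "\<And>j. sublist v (\<omega> @ take j v) \<Longrightarrow> i \<le> j"
    unfolding i_def
    using LeastI[where P = "\<lambda>i. sublist v (\<omega> @ take i v)", OF ex]
      Least_le[where P = "\<lambda>i. sublist v (\<omega> @ take i v)"] ex by blast+
  have "i \<noteq> 0"
  proof
    assume "i = 0"
    then show False using i \<omega> by (simp add: Omega_n_def)
  qed
  have bl: "butlast (\<omega> @ take i v) = \<omega> @ take (i - 1) v"
    using \<open>i \<noteq> 0\<close> i_le assms by (auto simp: butlast_append butlast_take)
  have nsub: "\<not> sublist v (butlast (\<omega> @ take i v))"
    using i_least[of "i - 1"] \<open>i \<noteq> 0\<close> unfolding bl by auto
  then obtain p where p: "\<omega> @ take i v = p @ v"
    using sublist_butlast_or_suffix[OF i] by (auto simp: suffix_def)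
  have len: "n + i = length p + length v"
    using arg_cong[OF p, of length] i_le \<omega> by (simp add: Omega_n_def)
  let ?u = "take i v"
  have "suffix ?u v" 
  proof -
    have "drop n (\<omega> @ take i v) = take i v" using \<omega> by (simp add: Omega_n_def)
    then have "take i v = drop n p @ drop (n - length p) v" using p by simp
    moreover have "drop n p = []" using len i_le by simp
    ultimately show ?thesis by (metis append_Nil suffix_drop)
  qed
  then have u: "?u \<in> borders v v"
    using \<open>i \<noteq> 0\<close> assms by (auto simp: borders_def take_is_prefix)
  have lu: "length ?u = i" using i_le by simp
  have "\<omega> = take n (p @ v)" using p \<omega> by (metis (mono_tags, lifting) Omega_n_def append_eq_conv_conj mem_Collect_eq)
  moreover have "length p \<le> n" "n - length p = length v - i" using len i_le by linarith+
  ultimately have "\<omega> = p @ take (length v - length ?u) v"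
    using lu by simp
  moreover have "p \<in> first_occ v (n - (length v - length ?u))"
    using nsub p len lu i_le by (auto simp: first_occ_def)
  ultimately show "\<omega> \<in> ?U" using u len lu i_le by force
next
  fix \<omega> assume "\<omega> \<in> ?U"
  then obtain u p where u: "u \<in> borders v v" "length v - length u \<le> n"
    and p: "p \<in> first_occ v (n - (length v - length u))"
    and \<omega>: "\<omega> = p @ take (length v - length u) v" by auto
  note b = borders_selfD[OF u(1)]
  have "length \<omega> = n" using \<omega> p u by (auto simp: first_occ_def)
  moreover have "prefix \<omega> (butlast (p @ v))"
  proof -
    have "butlast (p @ v) = p @ take (length v - 1) v"
      using assms by (simp add: butlast_append) (simp add: butlast_conv_take)
    moreover have "take (length v - length u) v = take (length v - length u) (take (length v - 1) v)"
      using b(1) by (cases u) auto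
    ultimately show ?thesis using \<omega> by (metis same_prefix_prefix take_is_prefix)
  qed
  ultimately show "\<omega> \<in> Omega_n v n"
    using p by (auto simp: Omega_n_def first_occ_def dest: prefix_imp_sublist sublist_order.order.trans)
qed

text \<open>For borders of different lengths, completing the common word by the longer border
  properly extends its completion by the shorter one, which already ends in \<open>v\<close>; so
  \<open>v\<close> would occur before the end.\<close>

lemma first_occ_overlap_unique:
  assumes u: "u \<in> borders v v" "u' \<in> borders v v"
    and p: "p \<in> first_occ v n" "p' \<in> first_occ v n'"
    and eq: "p @ take (length v - length u) v = p' @ take (length v - length u') v"
  shows "u = u' \<and> p = p'"
proof -
  have app: "q @ v = (q @ take (length v - length x) v) @ x" if "x \<in> borders v v" for q x
    using that borders_selfD(4)[OF that] by (metis append.assoc append_take_drop_id)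
  have less: False
    if x: "x \<in> borders v v" "x' \<in> borders v v" and q: "q' \<in> first_occ v N"
      and e: "q @ take (length v - length x) v = q' @ take (length v - length x') v"
      and l: "length x < length x'" for x x' q q' N
  proof -
    have "prefix x x'"
      using borders_selfD[OF x(1)] borders_selfD[OF x(2)] l
      by (metis order.strict_implies_order prefix_length_prefix take_is_prefix)
    then obtain z where z: "x' = x @ z" "z \<noteq> []" using l by (auto simp: prefix_def)
    have "q' @ v = (q @ v) @ z"
      unfolding app[OF x(1), of q] app[OF x(2), of q'] e z(1) by simp
    then have "sublist v (butlast (q' @ v))"
      using z(2) by (simp add: butlast_append)
    then show False using q by (simp add: first_occ_def)
  qed
  have "length u = length u'"
    using less[OF u p(2) eq] less[OF u(2,1) p(1) eq[symmetric]] by force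
  then have "u = u'" using borders_selfD(3)[OF u(1)] borders_selfD(3)[OF u(2)] by metis
  then show ?thesis using eq by (metis append_same_eq)
qed

lemma avoid_gf_eq:
  fixes y :: "'a::comm_ring_1"
  assumes "v \<noteq> []"
  shows "avoid_gf v y = corr_gf v y * first_gf v y"
proof (rule fps_ext)
  fix n
  let ?B = "{u\<in>borders v v. length v - length u \<le> n}"
  let ?l = "\<lambda>u. length v - length u"
  have "fps_nth (avoid_gf v y) n = (\<Sum>u\<in>?B. \<Sum>\<omega>\<in>(\<lambda>p. p @ take (?l u) v) ` first_occ v (n - ?l u). y ^ ones \<omega>)"
    unfolding avoid_gf_def fps_nth_Abs_fps avoiding_eq_Union_first_occ[OF assms, of n]
  proof (rule sum.UNION_disjoint, goal_cases)
    case 3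
    then show ?case
      using first_occ_overlap_unique[of _ v] by blast
  qed auto
  also have "\<dots> = (\<Sum>u\<in>?B. y ^ (ones v - ones u) * fps_nth (first_gf v y) (n - ?l u))"
  proof (rule sum.cong[OF refl])
    fix u assume "u \<in> ?B"
    then show "(\<Sum>\<omega>\<in>(\<lambda>p. p @ take (?l u) v) ` first_occ v (n - ?l u). y ^ ones \<omega>) =
      y ^ (ones v - ones u) * fps_nth (first_gf v y) (n - ?l u)"
      by (subst sum.reindex)
         (auto simp: inj_on_def ones_take_border first_gf_def sum_distrib_left power_add mult.commute)
  qed
  also have "\<dots> = (\<Sum>u\<in>borders v v. if n < ?l u then 0 else y ^ (ones v - ones u) * fps_nth (first_gf v y) (n - ?l u))"
    by (rule sum.mono_neutral_cong_left) auto
  also have "\<dots> = fps_nth (corr_gf v y * first_gf v y) n"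
    by (auto simp: corr_gf_def sum_distrib_right fps_sum_nth mult.assoc fps_X_power_mult_nth intro!: sum.cong)
  finally show "fps_nth (avoid_gf v y) n = fps_nth (corr_gf v y * first_gf v y) n" .
qed

text \<open>Substituting \<open>avoid_gf_eq\<close> into \<open>avoid_gf_step\<close> eliminates the
  avoiding words. That the reciprocal of \<open>denom_gf\<close> is a counting series is the source
  of all positivity used below.\<close>

lemma denom_gf_first_gf:
  assumes "v \<noteq> []"
  shows "denom_gf v y * first_gf v y = 1"
  using avoid_gf_step[OF assms, of y] unfolding denom_gf_def avoid_gf_eq[OF assms]
  by (simp add: algebra_simps)

subsection \<open>Stochastic domination\<close>

text \<open>Let \<open>b\<close> be the contribution of the proper borders to
  \<open>corr_gf w y\<close>. Each of them leaves \<open>d\<close> more ones outside it in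
  \<open>v\<close> than in \<open>w\<close>, so \<open>corr_gf v y\<close> is
  \<open>1 + \<delta> * b\<close>. In the cross-multiplied difference all terms with the factor
  \<open>t\<close> cancel.\<close>

lemma avoid_gf_diff:
  fixes y :: "'a::comm_ring_1"
  assumes "v \<noteq> []" "w \<noteq> []" and len: "length v = length w" and d: "ones v = ones w + d"
    and borders: "borders v v - {v} = borders w w - {w}"
  shows "avoid_gf v y - avoid_gf w y =
    fps_X ^ length w * fps_const (y ^ ones w * (1 - y ^ d)) * (first_gf v y * first_gf w y)"
proof -
  define b where "b = (\<Sum>u\<in>borders w w - {w}. fps_X ^ (length w - length u) * fps_const (y ^ (ones w - ones u)))"
  define \<delta> where "\<delta> = fps_const (y ^ d)"
  define P where "P = fps_X ^ length w * fps_const (y ^ ones w)"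
  define t where "t = 1 - fps_X * fps_const (1 + y)"
  define F G where "F = first_gf v y" and "G = first_gf w y"
  have self: "v \<in> borders v v" "w \<in> borders w w"
    using assms by (auto simp: borders_def)
  have cw: "corr_gf w y = 1 + b"
    unfolding corr_gf_def b_def by (subst sum.remove[OF finite_borders self(2)]) simp
  have "corr_gf v y = 1 + (\<Sum>u\<in>borders w w - {w}.
      fps_X ^ (length v - length u) * fps_const (y ^ (ones v - ones u)))"
    unfolding corr_gf_def borders[symmetric]
    by (subst sum.remove[OF finite_borders self(1)]) simp
  also have "(\<Sum>u\<in>borders w w - {w}. fps_X ^ (length v - length u) * fps_const (y ^ (ones v - ones u))) = \<delta> * b"
    unfolding b_def sum_distrib_left
  proof (rule sum.cong[OF refl])
    fix u assume "u \<in> borders w w - {w}"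
    then have "suffix u w" by (auto simp: borders_def)
    then have "ones v - ones u = d + (ones w - ones u)"
      using d by (auto simp: suffix_def)
    then show "fps_X ^ (length v - length u) * fps_const (y ^ (ones v - ones u)) =
      \<delta> * (fps_X ^ (length w - length u) * fps_const (y ^ (ones w - ones u)))"
      by (simp add: len \<delta>_def power_add fps_const_mult[symmetric] mult_ac del: fps_const_mult)
  qed
  finally have cv: "corr_gf v y = 1 + \<delta> * b" .
  have Q: "(P * \<delta> + t * (1 + \<delta> * b)) * F = 1" "(P + t * (1 + b)) * G = 1"
    using denom_gf_first_gf[OF assms(1), of y] denom_gf_first_gf[OF assms(2), of y]
    unfolding denom_gf_def cv cw len d P_def t_def F_def G_def \<delta>_def
    by (simp_all add: power_add fps_const_mult[symmetric] mult.assoc del: fps_const_mult)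
  \<comment> \<open>Each term is multiplied by the product from \<open>Q\<close> that belongs to the
    other word and equals 1, which makes \<open>F * G\<close> a common factor.\<close>
  have "avoid_gf v y - avoid_gf w y =
      (1 + \<delta> * b) * F * ((P + t * (1 + b)) * G) - (1 + b) * G * ((P * \<delta> + t * (1 + \<delta> * b)) * F)"
    unfolding Q avoid_gf_eq[OF assms(1)] avoid_gf_eq[OF assms(2)] cv cw by (simp add: F_def G_def)
  also have "\<dots> = P * (1 - \<delta>) * (F * G)"
    by (simp add: algebra_simps)
  also have "P * (1 - \<delta>) = fps_X ^ length w * fps_const (y ^ ones w * (1 - y ^ d))"
    unfolding P_def \<delta>_def
    by (simp add: algebra_simps fps_const_sub[symmetric] fps_const_mult[symmetric]
      del: fps_const_mult fps_const_sub)
  finally show ?thesis unfolding F_def G_def .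
qed

text \<open>At \<open>y = 1\<close> the factor \<open>1 - y ^ d\<close> vanishes.\<close>

lemma card_Omega_n_eq:
  assumes "v \<noteq> []" "w \<noteq> []" "length v = length w" "ones v \<ge> ones w"
    and "borders v v - {v} = borders w w - {w}"
  shows "card (Omega_n v n) = card (Omega_n w n)"
proof -
  obtain d where d: "ones v = ones w + d" using assms(4) le_Suc_ex by blast
  have "avoid_gf v (1::int) = avoid_gf w 1"
    using avoid_gf_diff[OF assms(1-3) d assms(5), of "1::int"] by simp
  then have "fps_nth (avoid_gf v (1::int)) n = fps_nth (avoid_gf w 1) n" by simp
  then show ?thesis by (simp add: avoid_gf_def)
qed

text \<open>Takes the place of dividing \<open>1 - y ^ d\<close> by \<open>1 - y\<close>: partial
  sums of coefficients amount to multiplication by \<open>1 / (1 - y)\<close>.\<close>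

lemma sum_shift_le:
  fixes S :: "nat \<Rightarrow> int"
  assumes "\<And>i. S i \<ge> 0"
  shows "(\<Sum>i\<le>K. if i < d then 0 else S (i - d)) \<le> (\<Sum>i\<le>K. S i)"
proof -
  have "(\<Sum>i\<le>K. if i < d then 0 else S (i - d)) = (\<Sum>i\<in>{d..K}. S (i - d))"
    by (rule sum.mono_neutral_cong_right) auto
  also have "\<dots> = (\<Sum>j\<in>(\<lambda>i. i - d) ` {d..K}. S j)"
    by (subst sum.reindex) (auto simp: inj_on_def)
  also have "\<dots> \<le> (\<Sum>i\<le>K. S i)"
    by (rule sum_mono2) (auto intro: assms)
  finally show ?thesis .
qed

lemma nth_avoid_gf_fps_X:
  "fps_nth (fps_nth (avoid_gf v (fps_X :: int fps)) n) i = int (card {\<omega>\<in>Omega_n v n. ones \<omega> = i})"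
proof -
  have "fps_nth (fps_nth (avoid_gf v (fps_X :: int fps)) n) i = (\<Sum>\<omega>\<in>Omega_n v n. if i = ones \<omega> then 1 else 0)"
    by (simp add: avoid_gf_def fps_sum_nth)
  also have "\<dots> = (\<Sum>\<omega>\<in>{\<omega>\<in>Omega_n v n. ones \<omega> = i}. 1)"
    by (rule sum.mono_neutral_cong_right) auto
  finally show ?thesis by simp
qed

lemma card_ones_le_eq_sum:
  "int (card {\<omega>\<in>Omega_n v n. ones \<omega> \<le> K}) = (\<Sum>i\<le>K. fps_nth (fps_nth (avoid_gf v (fps_X :: int fps)) n) i)"
proof -
  have "{\<omega>\<in>Omega_n v n. ones \<omega> \<le> K} = (\<Union>i\<in>{..K}. {\<omega>\<in>Omega_n v n. ones \<omega> = i})"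
    by auto
  also have "card \<dots> = (\<Sum>i\<le>K. card {\<omega>\<in>Omega_n v n. ones \<omega> = i})"
    by (rule card_UN_disjoint) auto
  finally show ?thesis by (simp add: nth_avoid_gf_fps_X)
qed

text \<open>At \<open>y = fps_X\<close>, the coefficient of \<open>z^n\<close> in
  \<open>avoid_gf_diff\<close> is zero or a series \<open>S\<close> with non-negative coefficients
  minus its shift by \<open>d\<close>, so its partial sums are non-negative.\<close>

lemma card_ones_le_mono:
  assumes "v \<noteq> []" "w \<noteq> []" "length v = length w" "ones v \<ge> ones w"
    and "borders v v - {v} = borders w w - {w}"
  shows "card {\<omega>\<in>Omega_n w n. ones \<omega> \<le> K} \<le> card {\<omega>\<in>Omega_n v n. ones \<omega> \<le> K}"
proof -
  obtain d where d: "ones v = ones w + d" using assms(4) le_Suc_ex by blast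
  let ?X = "fps_X :: int fps"
  define H where "H = first_gf v ?X * first_gf w ?X"
  have first: "fps_nth (fps_nth (first_gf u ?X) j) i \<ge> 0" for u j i
    by (auto simp: first_gf_def fps_sum_nth intro!: sum_nonneg)
  have H: "fps_nth (fps_nth H j) i \<ge> 0" for j i
    unfolding H_def fps_mult_nth fps_sum_nth
    by (intro sum_nonneg mult_nonneg_nonneg first)
  have "(\<Sum>i\<le>K. fps_nth (fps_nth (avoid_gf v ?X - avoid_gf w ?X) n) i) \<ge> 0"
  proof (cases "n < length w")
    case True
    then show ?thesis
      unfolding avoid_gf_diff[OF assms(1-3) d assms(5)] by (simp add: mult.assoc fps_X_power_mult_nth)
  next
    case False
    define S where "S = ?X ^ ones w * fps_nth H (n - length w)"
    have S: "fps_nth S i \<ge> 0" for i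
      unfolding S_def by (simp add: fps_X_power_mult_nth H)
    have "fps_nth (avoid_gf v ?X - avoid_gf w ?X) n = S - ?X ^ d * S"
      unfolding avoid_gf_diff[OF assms(1-3) d assms(5)] H_def[symmetric] S_def mult.assoc using False
      by (simp add: fps_X_power_mult_nth) (simp add: algebra_simps)
    then show ?thesis
      using sum_shift_le[of "fps_nth S" d K, OF S]
      by (simp add: fps_X_power_mult_nth sum_subtractf)
  qed
  then show ?thesis
    using card_ones_le_eq_sum[of v n K] card_ones_le_eq_sum[of w n K] by (simp add: sum_subtractf)
qed

text \<open>Greedy matching: an \<open>x\<close> with minimal \<open>f\<close> gets any
  \<open>y\<close> with \<open>g y \<le> f x\<close>. Removing the pair preserves the counting
  condition: for \<open>k \<ge> f x\<close> both counts drop by one, and for smaller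
  \<open>k\<close> the left count is zero.\<close>

lemma ex_bij_betw_pointwise_le:
  fixes f :: "'a \<Rightarrow> nat" and g :: "'b \<Rightarrow> nat"
  assumes "finite X" "finite Y" "card X = card Y"
    and "\<And>k. card {x\<in>X. f x \<le> k} \<le> card {y\<in>Y. g y \<le> k}"
  shows "\<exists>h. bij_betw h X Y \<and> (\<forall>x\<in>X. g (h x) \<le> f x)"
  using assms
proof (induction "card X" arbitrary: X Y)
  case 0
  then have "X = {}" "Y = {}" by auto
  then show ?case by (auto simp: bij_betw_def)
next
  case (Suc n)
  then have "X \<noteq> {}" by auto
  then obtain x where x: "x \<in> X" "\<And>x'. x' \<in> X \<Longrightarrow> f x \<le> f x'"
    using arg_min_if_finite[OF \<open>finite X\<close>, of f] by (metis not_le)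
  have "card {x'\<in>X. f x' \<le> f x} > 0"
    using x Suc.prems(1) by (auto simp: card_gt_0_iff)
  then have "card {y\<in>Y. g y \<le> f x} > 0"
    using Suc.prems(4)[of "f x"] by linarith
  then obtain y where y: "y \<in> Y" "g y \<le> f x"
    by (auto simp: card_gt_0_iff)
  have "card {x'\<in>X - {x}. f x' \<le> k} \<le> card {y'\<in>Y - {y}. g y' \<le> k}" for k
  proof (cases "f x \<le> k")
    case True
    have "{x'\<in>X - {x}. f x' \<le> k} = {x'\<in>X. f x' \<le> k} - {x}" "{y'\<in>Y - {y}. g y' \<le> k} = {y'\<in>Y. g y' \<le> k} - {y}"
      by auto
    then show ?thesis
      using Suc.prems(4)[of k] x y True Suc.prems(1,2) by simp
  next
    case False
    then have "{x'\<in>X - {x}. f x' \<le> k} = {}" using x(2) by (force simp: not_le)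
    then show ?thesis by (metis card.empty le0)
  qed
  moreover have "n = card (X - {x})" "card (X - {x}) = card (Y - {y})"
    using Suc x y by auto
  ultimately obtain h where h: "bij_betw h (X - {x}) (Y - {y})" "\<forall>x\<in>X - {x}. g (h x) \<le> f x"
    using Suc.hyps(1)[of "X - {x}" "Y - {y}"] Suc.prems(1,2) by (metis finite_Diff)
  have "bij_betw (h(x := y)) (X - {x}) (Y - {y})"
    using h(1) by (subst bij_betw_cong[where g = h]) auto
  then have "bij_betw (h(x := y)) ((X - {x}) \<union> {x}) ((Y - {y}) \<union> {y})"
    by (rule bij_betw_combine) (auto simp: bij_betw_def)
  then have "bij_betw (h(x := y)) X Y"
    using x y by (simp add: insert_absorb)
  moreover have "\<forall>x'\<in>X. g ((h(x := y)) x') \<le> f x'"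
    using h(2) y by auto
  ultimately show ?case by blast
qed

section \<open>Bijections between avoiding words of all lengths\<close>

lemma bij_betw_Omega:
  assumes "\<And>n. n \<ge> 1 \<Longrightarrow> bij_betw (h n) (Omega_n w n) (Omega_n v n)"
  shows "bij_betw (\<lambda>\<omega>. h (length \<omega>) \<omega>) (Omega w) (Omega v)"
    and "length_preserving w v (\<lambda>\<omega>. h (length \<omega>) \<omega>)"
proof -
  let ?\<kappa> = "\<lambda>\<omega>. h (length \<omega>) \<omega>"
  have len: "\<omega> \<in> Omega_n x n \<Longrightarrow> length \<omega> = n" for \<omega> x n
    by (simp add: Omega_n_def)
  have img: "?\<kappa> ` Omega_n w n = Omega_n v n" if "n \<ge> 1" for n
  proof -
    have "?\<kappa> ` Omega_n w n = h n ` Omega_n w n"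
      by (rule image_cong) (auto simp: len)
    then show ?thesis using assms[OF that] by (simp add: bij_betw_def)
  qed
  then show "length_preserving w v ?\<kappa>" by (auto simp: length_preserving_def)
  show "bij_betw ?\<kappa> (Omega w) (Omega v)"
  proof (rule bij_betw_imageI)
    show "inj_on ?\<kappa> (Omega w)"
    proof (rule inj_onI)
      fix a b assume a: "a \<in> Omega w" and b: "b \<in> Omega w" and eq: "?\<kappa> a = ?\<kappa> b"
      have k: "length (?\<kappa> x) = length x" "x \<in> Omega_n w (length x)" "length x \<ge> 1" if "x \<in> Omega w" for x
      proof -
        obtain n where n: "n \<ge> 1" "x \<in> Omega_n w n" using \<open>x \<in> Omega w\<close> by (auto simp: Omega_def)
        then have "?\<kappa> x \<in> Omega_n v n" using img[OF n(1)] by blast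
        with n show "length (?\<kappa> x) = length x" "x \<in> Omega_n w (length x)" "length x \<ge> 1"
          by (auto simp: len)
      qed
      have "length a = length b" using k(1)[OF a] k(1)[OF b] eq by simp
      then show "a = b"
        using assms[OF k(3)[OF a]] k(2)[OF a] k(2)[OF b] eq by (auto simp: bij_betw_def inj_on_def)
    qed
    show "?\<kappa> ` Omega w = Omega v"
      unfolding Omega_def image_UN by (rule SUP_cong) (auto simp: img)
  qed
qed

lemma ex_ones_decreasing_bij_Omega_n:
  assumes "v \<noteq> []" "w \<noteq> []" "length v = length w" "ones v \<ge> ones w"
    and "borders v v - {v} = borders w w - {w}"
  shows "\<exists>h. bij_betw h (Omega_n w n) (Omega_n v n) \<and> (\<forall>\<omega>\<in>Omega_n w n. ones (h \<omega>) \<le> ones \<omega>)"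
  using ex_bij_betw_pointwise_le[of _ _ ones ones] card_ones_le_mono[OF assms] card_Omega_n_eq[OF assms]
  by simp

lemma ex_ones_decreasing_bij:
  assumes "v \<noteq> []" "w \<noteq> []" "length v = length w" "ones v \<ge> ones w"
    and "borders v v - {v} = borders w w - {w}"
  shows "\<exists>\<kappa>. length_preserving w v \<kappa> \<and> bij_betw \<kappa> (Omega w) (Omega v) \<and>
            (\<forall>\<omega>\<in>Omega w. ones \<omega> \<ge> ones (\<kappa> \<omega>))"
proof -
  obtain h where h: "\<And>n. bij_betw (h n) (Omega_n w n) (Omega_n v n)"
     "\<And>n \<omega>. \<omega> \<in> Omega_n w n \<Longrightarrow> ones (h n \<omega>) \<le> ones \<omega>"
    using ex_ones_decreasing_bij_Omega_n[OF assms] by metis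
  have "ones (h (length \<omega>) \<omega>) \<le> ones \<omega>" if "\<omega> \<in> Omega w" for \<omega>
    using h(2)[of \<omega> "length \<omega>"] that by (auto simp: Omega_def Omega_n_def)
  then show ?thesis using bij_betw_Omega[of h w v, OF h(1)] by blast
qed

lemma sum_ones_mono:
  assumes "v \<noteq> []" "w \<noteq> []" "length v = length w" "ones v \<ge> ones w"
    and "borders v v - {v} = borders w w - {w}"
  shows "(\<Sum>\<omega>\<in>Omega_n v n. real (ones \<omega>)) \<le> (\<Sum>\<omega>\<in>Omega_n w n. real (ones \<omega>))"
proof -
  obtain h where h: "bij_betw h (Omega_n w n) (Omega_n v n)" "\<forall>\<omega>\<in>Omega_n w n. ones (h \<omega>) \<le> ones \<omega>"
    using ex_ones_decreasing_bij_Omega_n[OF assms] by blast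
  have "(\<Sum>\<omega>\<in>Omega_n v n. real (ones \<omega>)) = (\<Sum>\<omega>\<in>Omega_n w n. real (ones (h \<omega>)))"
    using sum.reindex_bij_betw[OF h(1), of "\<lambda>\<omega>. real (ones \<omega>)"] by simp
  also have "\<dots> \<le> (\<Sum>\<omega>\<in>Omega_n w n. real (ones \<omega>))" using h(2) by (intro sum_mono) simp
  finally show ?thesis .
qed

text \<open>With equal numbers of ones the domination goes both ways, so the sequences
  \<open>rho_n\<close> agree term by term; no statement about their limit enters.\<close>

lemma rho_eq_if_ones_eq:
  assumes "v \<noteq> []" "w \<noteq> []" "length v = length w" "ones v = ones w"
    and "borders v v - {v} = borders w w - {w}"
  shows "rho v = rho w"
proof -
  have "rho_n v n = rho_n w n" for n
    unfolding rho_n_def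
    using sum_ones_mono[of v w n] sum_ones_mono[of w v n] card_Omega_n_eq[of v w n] assms by simp
  then have "rho_n v = rho_n w" by (rule ext)
  then show ?thesis by (simp add: rho_def)
qed

subsection \<open>Simultaneous replacement\<close>

definition occ :: "bool list \<Rightarrow> bool list \<Rightarrow> nat \<Rightarrow> bool" where
  "occ v \<omega> p \<longleftrightarrow> p + length v \<le> length \<omega> \<and> (\<forall>l<length v. \<omega> ! (p + l) = v ! l)"

lemma sublist_iff_occ: "sublist v \<omega> \<longleftrightarrow> (\<exists>p. occ v \<omega> p)"
proof
  assume "sublist v \<omega>"
  then obtain ps ss where "\<omega> = ps @ v @ ss" by (auto simp: sublist_def)
  then have "occ v \<omega> (length ps)" by (auto simp: occ_def nth_append)
  then show "\<exists>p. occ v \<omega> p" by blast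
next
  assume "\<exists>p. occ v \<omega> p"
  then obtain p where "occ v \<omega> p" by blast
  then have "v = take (length v) (drop p \<omega>)"
    by (intro nth_equalityI) (auto simp: occ_def)
  then have "\<omega> = take p \<omega> @ v @ drop (length v) (drop p \<omega>)"
    by (metis append_take_drop_id)
  then show "sublist v \<omega>" by (metis sublist_def)
qed

lemma occ_nth:
  assumes "occ v \<omega> q" "q \<le> i" "i < q + length v"
  shows "\<omega> ! i = v ! (i - q)"
  using assms unfolding occ_def by (metis add_diff_inverse_nat le_add_diff_inverse nat_add_left_cancel_less not_le)

text \<open>Several occurrences of \<open>a\<close> may cover position \<open>i\<close>;
  \<open>LEAST\<close> settles on the one that starts last. Under the border hypotheses any other
  choice gives the same letter, see \<open>replace_all_nth_covered\<close>.\<close>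

definition replace_all :: "bool list \<Rightarrow> bool list \<Rightarrow> bool list \<Rightarrow> bool list" where
  "replace_all a b \<omega> =
     map (\<lambda>i. if \<exists>j<length a. j \<le> i \<and> occ a \<omega> (i - j)
              then b ! (LEAST j. j < length a \<and> j \<le> i \<and> occ a \<omega> (i - j)) else \<omega> ! i) [0..<length \<omega>]"

lemma length_replace_all [simp]: "length (replace_all a b \<omega>) = length \<omega>"
  by (simp add: replace_all_def)

lemma replace_all_nth:
  "i < length \<omega> \<Longrightarrow> replace_all a b \<omega> ! i =
     (if \<exists>j<length a. j \<le> i \<and> occ a \<omega> (i - j)
      then b ! (LEAST j. j < length a \<and> j \<le> i \<and> occ a \<omega> (i - j)) else \<omega> ! i)"
  unfolding replace_all_def by (simp only: nth_map length_upt diff_zero nth_upt add_0)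

lemma ones_eq_sum: "int (ones xs) = (\<Sum>i<length xs. of_bool (xs ! i))"
proof (induction xs)
  case (Cons b xs)
  have "(\<Sum>i<length (b # xs). of_bool ((b # xs) ! i) :: int) = of_bool b + (\<Sum>i<length xs. of_bool (xs ! i))"
    by (simp only: length_Cons sum.lessThan_Suc_shift nth_Cons_0 nth_Cons_Suc)
  then show ?case using Cons.IH by simp
qed simp

context
  fixes v w :: "bool list"
  assumes len: "length v = length w"
    and borders_eq: "borders v v - {v} = borders w w - {w}" "borders w w - {w} = borders v w"
      "borders v w = borders w v"
begin

text \<open>Every overlap of two occurrences of \<open>v\<close> or \<open>w\<close> is a border common to all four pairs, so
  exchanging \<open>v\<close> and \<open>w\<close> does not affect the overlap.\<close>

lemma agree_on_overlap:
  assumes "a \<in> {v, w}" "b \<in> {v, w}" and r: "0 < r" "r < length v"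
    and ov: "\<And>j. r \<le> j \<Longrightarrow> j < length v \<Longrightarrow> a ! j = b ! (j - r)"
  shows "\<And>j. r \<le> j \<Longrightarrow> j < length v \<Longrightarrow> v ! j = w ! j" "\<And>j. j < length v - r \<Longrightarrow> v ! j = w ! j"
proof -
  define u where "u = drop r a"
  have l: "length a = length v" "length b = length v" using assms(1,2) len by auto
  have "u = take (length v - r) b"
    unfolding u_def using ov[of "r + _"] l r by (intro nth_equalityI) auto
  then have "u \<in> borders a b"
    using r l suffix_drop[of r a] take_is_prefix[of "length v - r" b] by (auto simp: borders_def u_def)
  moreover have "length u < length v" using r l by (simp add: u_def)
  then have "u \<noteq> v" "u \<noteq> w" using len by auto
  ultimately have "u \<in> borders v v" "u \<in> borders w w"
    using assms(1,2) borders_eq by auto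
  then have *: "take (length u) v = u" "drop (length v - length u) v = u"
    "take (length u) w = u" "drop (length w - length u) w = u"
    using borders_selfD by blast+
  have lu: "length u = length v - r" using l by (simp add: u_def)
  show "v ! j = w ! j" if "r \<le> j" "j < length v" for j
  proof -
    have "drop r v = drop r w" using * lu len r by simp
    then have "drop r v ! (j - r) = drop r w ! (j - r)" by simp
    then show ?thesis using that len by simp
  qed
  show "v ! j = w ! j" if "j < length v - r" for j
    using * lu that by (metis nth_take)
qed

text \<open>Where two occurrences overlap, \<open>v\<close> and \<open>w\<close> have the same
  letter, so an exchange leaves that position alone. The occurrence that starts first plays the role
  of \<open>a\<close> in \<open>agree_on_overlap\<close>.\<close>

lemma agree_on_overlapping_occs:
  assumes ab: "a \<in> {v, w}" "b \<in> {v, w}" and occ: "occ a \<omega> p" "occ b \<omega> q" and "p \<noteq> q"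
    and i: "p \<le> i" "i < p + length v" "q \<le> i" "i < q + length v"
  shows "v ! (i - p) = w ! (i - p) \<and> v ! (i - q) = w ! (i - q)"
proof -
  have less: "v ! (i - p) = w ! (i - p) \<and> v ! (i - q) = w ! (i - q)"
    if ab: "a \<in> {v, w}" "b \<in> {v, w}" and occ: "occ a \<omega> p" "occ b \<omega> q" and "p < q"
      and i: "q \<le> i" "i < p + length v" for a b p q
  proof -
    have l: "length a = length v" "length b = length v" using ab len by auto
    have ov: "a ! j = b ! (j - (q - p))" if "q - p \<le> j" "j < length v" for j
    proof -
      have "p + j - q = j - (q - p)" "q \<le> p + j" "p + j < q + length v" using that \<open>p < q\<close> by linarith+
      then show ?thesis
        using occ_nth[OF occ(1), of "p + j"] occ_nth[OF occ(2), of "p + j"] that l by simp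
    qed
    have r: "0 < q - p" "q - p < length v" using \<open>p < q\<close> i by auto
    note ag = agree_on_overlap[OF ab r ov]
    show ?thesis using ag(1)[of "i - p"] ag(2)[of "i - q"] i \<open>p < q\<close> by auto
  qed
  show ?thesis
    using less[OF ab occ _ i(3,2)] less[OF ab(2,1) occ(2,1) _ i(1,4)] \<open>p \<noteq> q\<close> by linarith
qed

text \<open>If two occurrences of \<open>a\<close> cover \<open>i\<close>, then \<open>v\<close> and
  \<open>w\<close> agree at both offsets, and \<open>a\<close> carries the letter
  \<open>\<omega> ! i\<close> at both; hence the choice made by \<open>LEAST\<close> does not
  matter.\<close>

lemma replace_all_nth_covered:
  assumes ab: "a \<in> {v, w}" "b \<in> {v, w}" and occ: "occ a \<omega> q" "q \<le> i" "i < q + length v"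
  shows "replace_all a b \<omega> ! i = b ! (i - q)"
proof -
  let ?P = "\<lambda>j. j < length a \<and> j \<le> i \<and> occ a \<omega> (i - j)"
  define j where "j = (LEAST j. ?P j)"
  have la: "length a = length v" using ab len by auto
  have "?P (i - q)" using occ la by auto
  then have ex: "\<exists>j. ?P j" and j: "?P j" unfolding j_def by (blast, rule LeastI)
  have i: "i < length \<omega>" using occ la by (auto simp: occ_def)
  have rep: "replace_all a b \<omega> ! i = b ! j"
    using i ex unfolding replace_all_def j_def by auto
  show ?thesis
  proof (cases "i - j = q")
    case True
    then show ?thesis using rep j by auto
  next
    case False
    have "v ! (i - q) = w ! (i - q) \<and> v ! j = w ! j"
      using agree_on_overlapping_occs[OF ab(1) ab(1) occ(1) conjunct2[OF conjunct2[OF j]], of i] False occ j la by auto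
    moreover have "a ! (i - q) = a ! j"
    proof -
      have "i - j \<le> i" "i < i - j + length a" "i - (i - j) = j" using j by linarith+
      then show ?thesis
        using occ_nth[OF occ(1), of i] occ_nth[of a \<omega> "i - j" i] occ j la by simp
    qed
    ultimately show ?thesis using rep ab by auto
  qed
qed

lemma replace_all_nth_uncovered:
  assumes "i < length \<omega>" "\<And>q. occ a \<omega> q \<Longrightarrow> q \<le> i \<Longrightarrow> i < q + length a \<Longrightarrow> False"
  shows "replace_all a b \<omega> ! i = \<omega> ! i"
proof -
  have "\<not> (\<exists>j<length a. j \<le> i \<and> occ a \<omega> (i - j))"
    using assms(2)[of "i - _"] by fastforce
  then show ?thesis unfolding replace_all_nth[OF assms(1)] by (rule if_not_P)
qed

text \<open>An exchanged occurrence at \<open>q\<close> that meets the one at \<open>p\<close> has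
  become an occurrence of \<open>b\<close>, with \<open>q \<noteq> p\<close> because
  \<open>a\<close> did not occur at \<open>p\<close>. On the overlap \<open>v\<close> and
  \<open>w\<close> agree, so the letters there are still those of \<open>\<omega>\<close>.\<close>

lemma occ_replace_all_old:
  assumes abc: "a \<in> {v, w}" "b \<in> {v, w}" "c \<in> {v, w}"
    and occ: "occ c (replace_all a b \<omega>) p" and nocc: "\<not> occ a \<omega> p"
  shows "occ c \<omega> p"
proof -
  have l: "length a = length v" "length b = length v" "length c = length v" using abc len by auto
  have "\<omega> ! (p + l) = c ! l" if "l < length c" for l
  proof -
    let ?i = "p + l"
    have i: "?i < length \<omega>" using occ that by (auto simp: occ_def)
    have c: "replace_all a b \<omega> ! ?i = c ! l" using occ that by (auto simp: occ_def)
    have "replace_all a b \<omega> ! ?i = \<omega> ! ?i"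
    proof (cases "\<exists>q. occ a \<omega> q \<and> q \<le> ?i \<and> ?i < q + length a")
      case True
      then obtain q where q: "occ a \<omega> q" "q \<le> ?i" "?i < q + length v" using l by auto
      have "occ b (replace_all a b \<omega>) q"
        using q(1) l replace_all_nth_covered[OF abc(1,2) q(1)] by (auto simp: occ_def)
      moreover have "p \<noteq> q" using q nocc by auto
      ultimately have "v ! (?i - q) = w ! (?i - q)"
        using agree_on_overlapping_occs[OF abc(3,2) occ, of q ?i] q that l by auto
      then show ?thesis
        using replace_all_nth_covered[OF abc(1,2) q] occ_nth[OF q(1,2)] q(3) l abc by auto
    next
      case False
      then show ?thesis using replace_all_nth_uncovered[OF i] by blast
    qed
    then show ?thesis using c by simp
  qed
  then show ?thesis using occ by (auto simp: occ_def)
qed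

lemma occ_replace_all_new:
  assumes ab: "a \<in> {v, w}" "b \<in> {v, w}" and "occ a \<omega> p"
  shows "occ b (replace_all a b \<omega>) p"
  using assms replace_all_nth_covered[OF ab assms(3)] len by (auto simp: occ_def)

lemma not_occ_replace_all:
  assumes ab: "a \<in> {v, w}" "b \<in> {v, w}" "a \<noteq> b"
  shows "\<not> occ a (replace_all a b \<omega>) p"
proof
  assume *: "occ a (replace_all a b \<omega>) p"
  then have "occ a \<omega> p" using occ_replace_all_old[OF ab(1,2,1) *] by blast
  then have "occ b (replace_all a b \<omega>) p" by (rule occ_replace_all_new[OF ab(1,2)])
  with * have "a = b"
    using ab len by (intro nth_equalityI) (auto simp: occ_def)
  with ab show False by simp
qed

text \<open>As \<open>\<omega>\<close> avoids \<open>b\<close>, the occurrences of \<open>b\<close>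
  after the exchange sit exactly where \<open>a\<close> occurred before, and the second exchange
  undoes the first.\<close>

lemma replace_all_inverse:
  assumes ab: "a \<in> {v, w}" "b \<in> {v, w}" and avoids: "\<And>p. \<not> occ b \<omega> p"
  shows "replace_all b a (replace_all a b \<omega>) = \<omega>"
proof (rule nth_equalityI)
  fix i assume "i < length (replace_all b a (replace_all a b \<omega>))"
  then have i: "i < length \<omega>" by simp
  have l: "length a = length v" "length b = length v" using ab len by auto
  have iff: "occ b (replace_all a b \<omega>) q \<longleftrightarrow> occ a \<omega> q" for q
    using occ_replace_all_new[OF ab] occ_replace_all_old[OF ab ab(2)] avoids by blast
  show "replace_all b a (replace_all a b \<omega>) ! i = \<omega> ! i"
  proof (cases "\<exists>q. occ a \<omega> q \<and> q \<le> i \<and> i < q + length v")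
    case True
    then obtain q where q: "occ a \<omega> q" "q \<le> i" "i < q + length v" by blast
    then show ?thesis
      using replace_all_nth_covered[OF ab(2,1), of "replace_all a b \<omega>" q i] occ_nth[OF q(1,2)] iff l by auto
  next
    case False
    have "replace_all b a (replace_all a b \<omega>) ! i = replace_all a b \<omega> ! i"
      by (rule replace_all_nth_uncovered) (use i False iff l in auto)
    also have "\<dots> = \<omega> ! i"
      by (rule replace_all_nth_uncovered) (use i False l in auto)
    finally show ?thesis .
  qed
qed simp

text \<open>Double counting: the number of ones drops by \<open>ones v - ones w\<close> for each
  occurrence of \<open>v\<close>. Positions covered several times cause no conflict, since every
  occurrence covering them contributes 0 there.\<close>

lemma ones_replace_all:
  assumes ge: "ones v \<ge> ones w"
  shows "ones (replace_all v w \<omega>) \<le> ones \<omega>"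
proof -
  let ?f = "\<lambda>x j. of_bool (x ! j) :: int"
  let ?n = "length \<omega>" and ?S = "{q\<in>{..length \<omega>}. occ v \<omega> q}"
  have S: "occ v \<omega> q \<Longrightarrow> q \<le> ?n" for q by (simp add: occ_def)
  have vw: "v \<in> {v, w}" "w \<in> {v, w}" by auto
  have "int (ones \<omega>) - int (ones (replace_all v w \<omega>)) =
    (\<Sum>i<?n. ?f \<omega> i - ?f (replace_all v w \<omega>) i)"
    by (simp add: ones_eq_sum sum_subtractf)
  also have "\<dots> = (\<Sum>i<?n. \<Sum>q\<in>{q\<in>?S. q \<le> i \<and> i < q + length v}. ?f v (i - q) - ?f w (i - q))"
  proof (rule sum.cong[OF refl])
    fix i assume "i \<in> {..<?n}"
    then have i: "i < ?n" by simp
    let ?C = "{q\<in>?S. q \<le> i \<and> i < q + length v}"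
    show "?f \<omega> i - ?f (replace_all v w \<omega>) i = (\<Sum>q\<in>?C. ?f v (i - q) - ?f w (i - q))"
    proof (cases "?C = {}")
      case True
      then have "replace_all v w \<omega> ! i = \<omega> ! i"
        by (intro replace_all_nth_uncovered[OF i]) (use S in blast)
      then show ?thesis unfolding True by simp
    next
      case False
      then obtain q where q: "q \<in> ?C" by blast
      have "(\<Sum>q\<in>?C. ?f v (i - q) - ?f w (i - q)) = ?f v (i - q) - ?f w (i - q) +
        (\<Sum>q\<in>?C - {q}. ?f v (i - q) - ?f w (i - q))"
        by (rule sum.remove) (use q in auto)
      also have "(\<Sum>q\<in>?C - {q}. ?f v (i - q) - ?f w (i - q)) = 0"
      proof (rule sum.neutral, rule ballI)
        fix q' assume "q' \<in> ?C - {q}"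
        then show "?f v (i - q') - ?f w (i - q') = 0"
          using agree_on_overlapping_occs[OF vw(1,1), of \<omega> q' q i] q by auto
      qed
      finally show ?thesis
        using q replace_all_nth_covered[OF vw, of \<omega> q i] occ_nth[of v \<omega> q i] by simp
    qed
  qed
  also have "\<dots> = (\<Sum>q\<in>?S. \<Sum>i\<in>{i\<in>{..<?n}. q \<le> i \<and> i < q + length v}. ?f v (i - q) - ?f w (i - q))"
    by (rule sum.swap_restrict) auto
  also have "\<dots> = (\<Sum>q\<in>?S. \<Sum>j<length v. ?f v j - ?f w j)"
  proof (rule sum.cong[OF refl])
    fix q assume "q \<in> ?S"
    then have "q + length v \<le> ?n" by (simp add: occ_def)
    then show "(\<Sum>i\<in>{i\<in>{..<?n}. q \<le> i \<and> i < q + length v}. ?f v (i - q) - ?f w (i - q)) =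
        (\<Sum>j<length v. ?f v j - ?f w j)"
      by (intro sum.reindex_bij_witness[of _ "\<lambda>j. j + q" "\<lambda>i. i - q"]) auto
  qed
  also have "\<dots> = (\<Sum>q\<in>?S. int (ones v) - int (ones w))"
    by (simp add: ones_eq_sum sum_subtractf len)
  also have "\<dots> \<ge> 0" using ge by (intro sum_nonneg) auto
  finally show ?thesis by simp
qed

lemma bij_betw_replace_all:
  assumes "v \<noteq> w"
  shows "bij_betw (replace_all v w) (Omega_n w n) (Omega_n v n)"
  by (rule bij_betwI[of _ _ _ "replace_all w v"])
     (use assms in \<open>auto simp: Omega_n_def sublist_iff_occ not_occ_replace_all replace_all_inverse\<close>)

end

section \<open>Locality of the replacement\<close>

lemma window_eq_Some_iff:
  "window R \<omega> i j = Some b \<longleftrightarrow>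
     \<bar>j\<bar> \<le> int R \<and> 0 \<le> int i + j \<and> int i + j < int (length \<omega>) \<and> \<omega> ! nat (int i + j) = b"
  by (auto simp: window_def)

text \<open>An occurrence covering \<open>i\<close> lies within distance \<open>length a\<close> of
  \<open>i\<close>, so the window sees all of it; the value \<open>Some\<close> also certifies that
  it stays inside the word.\<close>

lemma occ_iff_window:
  assumes "j < length a" "i < length \<omega>"
  shows "j \<le> i \<and> occ a \<omega> (i - j) \<longleftrightarrow> (\<forall>l<length a. window (length a) \<omega> i (int l - int j) = Some (a ! l))"
proof
  assume *: "j \<le> i \<and> occ a \<omega> (i - j)"
  show "\<forall>l<length a. window (length a) \<omega> i (int l - int j) = Some (a ! l)"
  proof (intro allI impI)
    fix l assume "l < length a"
    moreover have "nat (int i + (int l - int j)) = i - j + l" using * by linarith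
    ultimately show "window (length a) \<omega> i (int l - int j) = Some (a ! l)"
      using * assms unfolding window_eq_Some_iff occ_def by auto
  qed
next
  assume *: "\<forall>l<length a. window (length a) \<omega> i (int l - int j) = Some (a ! l)"
  have "0 < length a" using assms by linarith
  then have ij: "j \<le> i" using *[rule_format, of 0] by (simp add: window_eq_Some_iff)
  have "int i + (int (length a - 1) - int j) < int (length \<omega>)"
    using *[rule_format, of "length a - 1"] \<open>0 < length a\<close> unfolding window_eq_Some_iff by linarith
  then have "i - j + length a \<le> length \<omega>" using ij by linarith
  moreover have "\<omega> ! (i - j + l) = a ! l" if "l < length a" for l
  proof -
    have "nat (int i + (int l - int j)) = i - j + l" using ij by linarith
    then show ?thesis using *[rule_format, OF that] unfolding window_eq_Some_iff by simp
  qed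
  ultimately show "j \<le> i \<and> occ a \<omega> (i - j)" using ij by (simp add: occ_def)
qed

lemma bounded_coding_radius_replace_all: "bounded_coding_radius w (replace_all a b)"
proof -
  define P where "P = (\<lambda>(win :: int \<Rightarrow> bool option) j. j < length a \<and>
    (\<forall>l<length a. win (int l - int j) = Some (a ! l)))"
  \<comment> \<open>The rule repeats \<open>replace_all\<close> with occurrences read off the
    window; \<open>win 0\<close> is the letter at position \<open>i\<close> itself and hence not
    \<open>None\<close>.\<close>
  define f where "f = (\<lambda>win. if \<exists>j. P win j then b ! (LEAST j. P win j) else the (win 0))"
  have "replace_all a b \<omega> ! i = f (window (length a) \<omega> i)" if "i < length \<omega>" for \<omega> i
  proof -
    have "P (window (length a) \<omega> i) = (\<lambda>j. j < length a \<and> j \<le> i \<and> occ a \<omega> (i - j))"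
    proof
      fix j
      show "P (window (length a) \<omega> i) j = (j < length a \<and> j \<le> i \<and> occ a \<omega> (i - j))"
        unfolding P_def using occ_iff_window[OF _ that, of j a] by blast
    qed
    then show ?thesis
      unfolding f_def replace_all_nth[OF that]
      by (simp only:) (intro if_cong refl, use that in \<open>simp add: window_def\<close>)
  qed
  then show ?thesis unfolding bounded_coding_radius_def by (auto simp: Omega_n_def intro!: exI[of _ "length a"] exI[of _ f])
qed

subsection \<open>Growth rates and letter frequencies\<close>

text \<open>Absolute convergence is part of the notion so that products can be evaluated through the
  Cauchy product; identities of formal series thereby become identities of real numbers.\<close>

definition fps_abs_sums :: "real fps \<Rightarrow> real \<Rightarrow> real \<Rightarrow> bool" where
  "fps_abs_sums f z s \<longleftrightarrow> summable (\<lambda>n. \<bar>fps_nth f n * z ^ n\<bar>) \<and> (\<lambda>n. fps_nth f n * z ^ n) sums s"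

lemma fps_abs_sums_X_power: "fps_abs_sums (fps_X ^ k * fps_const c) z (z ^ k * c)"
proof -
  have *: "fps_nth (fps_X ^ k * fps_const c) n * z ^ n = (if n = k then c * z ^ k else 0)" for n
    by (auto simp: fps_X_power_mult_nth)
  have "summable (\<lambda>n. \<bar>if n = k then c * z ^ k else 0\<bar>)"
    by (rule summable_finite[of "{k}"]) auto
  moreover have "(\<lambda>n. if n = k then c * z ^ k else 0) sums (z ^ k * c)"
    using sums_single[of k "\<lambda>_. c * z ^ k"] by (simp add: mult.commute)
  ultimately show ?thesis unfolding fps_abs_sums_def * by simp
qed

lemma fps_abs_sums_add:
  assumes "fps_abs_sums f z s" "fps_abs_sums g z t"
  shows "fps_abs_sums (f + g) z (s + t)"
  using assms unfolding fps_abs_sums_def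
  by (auto simp: distrib_right intro!: sums_add
    intro: summable_comparison_test'[OF summable_add[of "\<lambda>n. \<bar>fps_nth f n * z ^ n\<bar>" "\<lambda>n. \<bar>fps_nth g n * z ^ n\<bar>"], of 0])

lemma fps_abs_sums_mult:
  assumes "fps_abs_sums f z s" "fps_abs_sums g z t"
  shows "fps_abs_sums (f * g) z (s * t)"
proof -
  let ?f = "\<lambda>n. fps_nth f n * z ^ n" and ?g = "\<lambda>n. fps_nth g n * z ^ n"
  have eq: "fps_nth (f * g) n * z ^ n = (\<Sum>i\<le>n. ?f i * ?g (n - i))" for n
  proof -
    have "fps_nth f i * fps_nth g (n - i) * z ^ n = ?f i * ?g (n - i)" if "i \<le> n" for i
    proof -
      have "z ^ n = z ^ i * z ^ (n - i)" using that by (simp add: power_add[symmetric])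
      then show ?thesis by (simp only: mult_ac)
    qed
    then show ?thesis
      unfolding fps_mult_nth sum_distrib_right atLeast0AtMost by (intro sum.cong) auto
  qed
  have s: "summable (\<lambda>n. norm (?f n))" "summable (\<lambda>n. norm (?g n))" "suminf ?f = s" "suminf ?g = t"
    using assms by (auto simp: fps_abs_sums_def sums_iff)
  have "summable (\<lambda>n. \<Sum>i\<le>n. \<bar>?f i\<bar> * \<bar>?g (n - i)\<bar>)"
    by (rule summable_Cauchy_product) (use s in simp_all)
  then have "summable (\<lambda>n. \<bar>fps_nth (f * g) n * z ^ n\<bar>)"
  proof (rule summable_comparison_test'[where N = 0])
    fix n
    show "norm \<bar>fps_nth (f * g) n * z ^ n\<bar> \<le> (\<Sum>i\<le>n. \<bar>?f i\<bar> * \<bar>?g (n - i)\<bar>)"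
      unfolding eq using sum_abs[of "\<lambda>i. ?f i * ?g (n - i)" "{..n}"] by (simp add: abs_mult)
  qed
  then show ?thesis
    using Cauchy_product_sums[OF s(1,2)] unfolding fps_abs_sums_def eq s by simp
qed

lemma fps_abs_sums_sum:
  "finite A \<Longrightarrow> (\<And>x. x \<in> A \<Longrightarrow> fps_abs_sums (f x) z (g x)) \<Longrightarrow> fps_abs_sums (sum f A) z (sum g A)"
proof (induction A rule: finite_induct)
  case empty
  then show ?case by (simp add: fps_abs_sums_def)
next
  case (insert x A)
  then show ?case by (simp add: fps_abs_sums_add)
qed

lemma fps_abs_sums_unique: "fps_abs_sums f z s \<Longrightarrow> fps_abs_sums f z t \<Longrightarrow> s = t"
  by (auto simp: fps_abs_sums_def intro: sums_unique2)

section \<open>The denominator as a function of two real variables\<close>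

definition corr :: "bool list \<Rightarrow> real \<Rightarrow> real \<Rightarrow> real" where
  "corr v z y = (\<Sum>u\<in>borders v v. z ^ (length v - length u) * y ^ (ones v - ones u))"

text \<open>Where natural subtraction truncates the exponent, the factor in front is 0; the same
  applies to \<open>corr_dy\<close>.\<close>

definition corr_dz :: "bool list \<Rightarrow> real \<Rightarrow> real \<Rightarrow> real" where
  "corr_dz v z y = (\<Sum>u\<in>borders v v.
     real (length v - length u) * z ^ (length v - length u - 1) * y ^ (ones v - ones u))"

definition corr_dy :: "bool list \<Rightarrow> real \<Rightarrow> real \<Rightarrow> real" where
  "corr_dy v z y = (\<Sum>u\<in>borders v v.
     z ^ (length v - length u) * (real (ones v - ones u) * y ^ (ones v - ones u - 1)))"

definition denom :: "bool list \<Rightarrow> real \<Rightarrow> real \<Rightarrow> real" where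
  "denom v z y = z ^ length v * y ^ ones v + (1 - z * (1 + y)) * corr v z y"

definition denom_dz :: "bool list \<Rightarrow> real \<Rightarrow> real \<Rightarrow> real" where
  "denom_dz v z y = real (length v) * z ^ (length v - 1) * y ^ ones v
     - (1 + y) * corr v z y + (1 - z * (1 + y)) * corr_dz v z y"

definition denom_dy :: "bool list \<Rightarrow> real \<Rightarrow> real \<Rightarrow> real" where
  "denom_dy v z y = z ^ length v * (real (ones v) * y ^ (ones v - 1))
     - z * corr v z y + (1 - z * (1 + y)) * corr_dy v z y"

lemma DERIV_corr:
  assumes "(X has_real_derivative X') (at h)" "(Y has_real_derivative Y') (at h)"
  shows "((\<lambda>h. corr v (X h) (Y h)) has_real_derivative
     corr_dz v (X h) (Y h) * X' + corr_dy v (X h) (Y h) * Y') (at h)"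
proof -
  have "((\<lambda>h. X h ^ i * Y h ^ j) has_real_derivative
     real i * X h ^ (i - 1) * Y h ^ j * X' + X h ^ i * (real j * Y h ^ (j - 1)) * Y') (at h)" for i j
    using assms by (auto intro!: derivative_eq_intros simp: algebra_simps)
  then show ?thesis
    unfolding corr_def corr_dz_def corr_dy_def sum_distrib_right sum.distrib[symmetric]
    by (intro DERIV_sum)
qed

lemma DERIV_denom:
  assumes "(X has_real_derivative X') (at h)" "(Y has_real_derivative Y') (at h)"
  shows "((\<lambda>h. denom v (X h) (Y h)) has_real_derivative
     denom_dz v (X h) (Y h) * X' + denom_dy v (X h) (Y h) * Y') (at h)"
  unfolding denom_def denom_dz_def denom_dy_def
  using assms by (auto intro!: derivative_eq_intros DERIV_corr simp: algebra_simps)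

lemma continuous_on_corr [continuous_intros]:
  assumes "continuous_on S f" "continuous_on S g"
  shows "continuous_on S (\<lambda>x. corr v (f x) (g x))"
    "continuous_on S (\<lambda>x. corr_dz v (f x) (g x))"
    "continuous_on S (\<lambda>x. corr_dy v (f x) (g x))"
  unfolding corr_def corr_dz_def corr_dy_def by (intro continuous_intros assms)+

lemma continuous_on_denom [continuous_intros]:
  assumes "continuous_on S f" "continuous_on S g"
  shows "continuous_on S (\<lambda>x. denom v (f x) (g x))"
    "continuous_on S (\<lambda>x. denom_dz v (f x) (g x))"
    "continuous_on S (\<lambda>x. denom_dy v (f x) (g x))"
  unfolding denom_def denom_dz_def denom_dy_def by (intro continuous_intros assms)+

lemma corr_ge_1:
  assumes "v \<noteq> []" "z \<ge> 0" "y \<ge> 0"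
  shows "corr v z y \<ge> 1"
proof -
  have "v \<in> borders v v" using assms by (auto simp: borders_def)
  then have "z ^ (length v - length v) * y ^ (ones v - ones v) \<le> corr v z y"
    unfolding corr_def using assms by (intro member_le_sum) auto
  then show ?thesis by simp
qed

section \<open>Weighted sums over avoiding words and their convergence\<close>

definition partition_sum :: "bool list \<Rightarrow> real \<Rightarrow> nat \<Rightarrow> real" where
  "partition_sum v y n = (\<Sum>\<omega>\<in>Omega_n v n. y ^ ones \<omega>)"

lemma partition_sum_nonneg: "y \<ge> 0 \<Longrightarrow> partition_sum v y n \<ge> 0"
  by (auto simp: partition_sum_def intro!: sum_nonneg)

text \<open>\<open>first_gf\<close> is cancelled formally before anything is evaluated, so only the
  series of the avoiding words raises a question of convergence; the other two are
  polynomials.\<close>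

lemma partition_sum_suminf_denom:
  assumes "v \<noteq> []" "z \<ge> 0" "y \<ge> 0" and "summable (\<lambda>n. partition_sum v y n * z ^ n)"
  shows "(\<Sum>n. partition_sum v y n * z ^ n) * denom v z y = corr v z y"
proof -
  have nth: "fps_nth (avoid_gf v y) n = partition_sum v y n" for n by (simp add: avoid_gf_def partition_sum_def)
  have F: "fps_abs_sums (avoid_gf v y) z (\<Sum>n. partition_sum v y n * z ^ n)"
    unfolding fps_abs_sums_def nth using assms partition_sum_nonneg[of y v] by (auto simp: summable_sums)
  have C: "fps_abs_sums (corr_gf v y) z (corr v z y)"
    unfolding corr_gf_def corr_def by (intro fps_abs_sums_sum fps_abs_sums_X_power finite_borders)
  have t: "fps_abs_sums (1 - fps_X * fps_const (1 + y)) z (1 - z * (1 + y))"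
  proof -
    have "1 - fps_X * fps_const (1 + y) = fps_X ^ 0 * fps_const 1 + fps_X ^ 1 * fps_const (- (1 + y))"
      by (simp add: fps_const_neg[symmetric] del: fps_const_neg fps_const_add)
    moreover have "1 - z * (1 + y) = z ^ 0 * 1 + z ^ 1 * (- (1 + y))" by (simp add: algebra_simps)
    ultimately show ?thesis using fps_abs_sums_add[OF fps_abs_sums_X_power fps_abs_sums_X_power] by metis
  qed
  have D: "fps_abs_sums (denom_gf v y) z (denom v z y)"
    unfolding denom_gf_def denom_def
    by (intro fps_abs_sums_add fps_abs_sums_mult fps_abs_sums_X_power C t)
  have "avoid_gf v y * denom_gf v y = corr_gf v y * (denom_gf v y * first_gf v y)"
    unfolding avoid_gf_eq[OF assms(1)] by (simp only: mult_ac)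
  then have "avoid_gf v y * denom_gf v y = corr_gf v y"
    by (simp add: denom_gf_first_gf[OF assms(1)])
  then show ?thesis using fps_abs_sums_mult[OF F D] C fps_abs_sums_unique by metis
qed

text \<open>Cutting an avoiding word after \<open>n\<close> letters gives two avoiding words that
  determine it.\<close>

lemma partition_sum_submult:
  assumes "y \<ge> 0"
  shows "partition_sum v y (n + m) \<le> partition_sum v y n * partition_sum v y m"
proof -
  let ?g = "\<lambda>\<omega>. (take n \<omega>, drop n \<omega>)"
  have "inj_on ?g (Omega_n v (n + m))"
    by (rule inj_onI) (metis append_take_drop_id prod.inject)
  then have "partition_sum v y (n + m) = (\<Sum>(p, s)\<in>?g ` Omega_n v (n + m). y ^ (ones p + ones s))"
    by (simp add: partition_sum_def sum.reindex case_prod_beta ones_append[symmetric] del: ones_append)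
  also have "\<dots> \<le> (\<Sum>(p, s)\<in>Omega_n v n \<times> Omega_n v m. y ^ (ones p + ones s))"
  proof (rule sum_mono2)
    show "?g ` Omega_n v (n + m) \<subseteq> Omega_n v n \<times> Omega_n v m"
    proof (rule image_subsetI)
      fix \<omega> assume \<omega>: "\<omega> \<in> Omega_n v (n + m)"
      then have "\<not> sublist v (take n \<omega> @ drop n \<omega>)" by (simp add: Omega_n_def)
      then have "\<not> sublist v (take n \<omega>)" "\<not> sublist v (drop n \<omega>)"
        by (metis sublist_append)+
      then show "?g \<omega> \<in> Omega_n v n \<times> Omega_n v m" using \<omega> by (auto simp: Omega_n_def)
    qed
  qed (use assms in auto)
  also have "\<dots> = partition_sum v y n * partition_sum v y m"
    by (simp add: partition_sum_def sum_product sum.cartesian_product power_add)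
  finally show ?thesis .
qed

text \<open>Division of \<open>n\<close> by \<open>N\<close> with remainder bounds
  \<open>s n\<close> by a multiple of \<open>c ^ (n div N)\<close> with
  \<open>s N \<le> c < 1\<close>, which decays geometrically.\<close>

lemma summable_submultiplicative:
  fixes s :: "nat \<Rightarrow> real"
  assumes nonneg: "\<And>n. s n \<ge> 0" and sub: "\<And>n m. s (n + m) \<le> s n * s m" and N: "N \<ge> 1" "s N < 1"
  shows "summable s"
proof -
  \<comment> \<open>The maximum keeps \<open>c\<close> positive even if \<open>s N = 0\<close>,
    because the bound below divides by \<open>c\<close>.\<close>
  define c where "c = max (s N) (1 / 2)"
  define t where "t = root N c"
  have c: "0 < c" "c < 1" "s N \<le> c" using N by (auto simp: c_def)
  have t: "0 < t" "t < 1" "t ^ N = c"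
    using N c by (auto simp: t_def real_root_pow_pos2)
  define M where "M = Max (s ` {..N})"
  have M: "s r \<le> M" if "r \<le> N" for r unfolding M_def using that by (intro Max_ge) auto
  have "M \<ge> 0" using M[of 0] nonneg[of 0] by simp
  have pow: "s (q * N + r) \<le> c ^ q * s r" for q r
  proof (induction q)
    case (Suc q)
    have "s (Suc q * N + r) \<le> s N * s (q * N + r)" using sub[of N "q * N + r"] by (simp add: add.assoc)
    also have "\<dots> \<le> c * (c ^ q * s r)" using Suc c nonneg by (intro mult_mono) auto
    finally show ?case by simp
  qed simp
  have bound: "s n \<le> M / c * t ^ n" for n
  proof -
    let ?q = "n div N" and ?r = "n mod N"
    have r: "?r < N" using N by simp
    have "s n \<le> c ^ ?q * s ?r" using pow[of ?q ?r] by simp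
    also have "\<dots> \<le> c ^ ?q * M" using M[of ?r] r c by (intro mult_left_mono) auto
    also have "c ^ ?q = t ^ (N * ?q)" using t by (simp add: power_mult)
    also have "t ^ (N * ?q) * M \<le> t ^ n / c * M"
    proof (rule mult_right_mono[OF _ \<open>M \<ge> 0\<close>])
      have "n \<le> N * ?q + N" using r by (metis add_left_mono less_imp_le mult_div_mod_eq)
      then have "t ^ (N * ?q + N) \<le> t ^ n" using t by (intro power_decreasing) auto
      then show "t ^ (N * ?q) \<le> t ^ n / c" using c t by (simp add: power_add field_simps)
    qed
    finally show ?thesis by (simp add: field_simps)
  qed
  show ?thesis
  proof (rule summable_comparison_test')
    show "summable (\<lambda>n. M / c * t ^ n)" using t by (intro summable_mult summable_geometric) auto
    show "norm (s n) \<le> M / c * t ^ n" for n using bound nonneg by simp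
  qed
qed

lemma partition_sum_summable_if_lt_1:
  assumes "y \<ge> 0" "z \<ge> 0" "N \<ge> 1" "partition_sum v y N * z ^ N < 1"
  shows "summable (\<lambda>n. partition_sum v y n * z ^ n)"
proof (rule summable_submultiplicative)
  show "partition_sum v y (n + m) * z ^ (n + m) \<le> partition_sum v y n * z ^ n * (partition_sum v y m * z ^ m)" for n m
    using mult_right_mono[OF partition_sum_submult[OF assms(1), of v n m], of "z ^ (n + m)"] assms(2)
    by (simp add: power_add mult_ac)
qed (use assms partition_sum_nonneg in auto)

text \<open>Submultiplicativity makes the series diverge on its circle of convergence, so its value
  \<open>corr / denom\<close> can only break down where \<open>denom\<close> vanishes.\<close>

lemma partition_sum_summable_if_denom_pos:
  assumes v: "v \<noteq> []" and y: "y \<ge> 0" and R: "R \<ge> 0"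
    and pos: "\<And>z. 0 \<le> z \<Longrightarrow> z \<le> R \<Longrightarrow> denom v z y > 0"
  shows "summable (\<lambda>n. partition_sum v y n * R ^ n)"
proof -
  \<comment> \<open>By compactness, one constant bounds the value of the series wherever it
    converges in \<open>{0..R}\<close>.\<close>
  have "\<exists>x\<in>{0..R}. \<forall>z\<in>{0..R}. corr v z y / denom v z y \<le> corr v x y / denom v x y"
    by (rule continuous_attains_sup) (use R pos in \<open>force intro!: continuous_intros\<close>)+
  then obtain B where B: "\<And>z. z \<in> {0..R} \<Longrightarrow> corr v z y / denom v z y \<le> B" by blast
  define S where "S = {z\<in>{0..R}. summable (\<lambda>n. partition_sum v y n * z ^ n)}"
  have partial: "(\<Sum>n<N. partition_sum v y n * z ^ n) \<le> B" if "z \<in> S" for z N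
  proof -
    have z: "0 \<le> z" "z \<le> R" "summable (\<lambda>n. partition_sum v y n * z ^ n)" using that by (auto simp: S_def)
    have "(\<Sum>n<N. partition_sum v y n * z ^ n) \<le> (\<Sum>n. partition_sum v y n * z ^ n)"
      by (rule sum_le_suminf) (use z partition_sum_nonneg[OF y] in auto)
    also have "\<dots> = corr v z y / denom v z y"
      using partition_sum_suminf_denom[OF v z(1) y z(3)] pos[OF z(1,2)] by (simp add: field_simps)
    finally show ?thesis using B z by force
  qed
  have "0 \<in> S" unfolding S_def using R
    by (auto intro!: summable_finite[of "{0}"] simp: power_0_left split: if_splits)
  have bdd: "bdd_above S" by (auto simp: S_def bdd_above_def)
  define b where "b = Sup S"
  have S_le: "z \<le> R" if "z \<in> S" for z using that by (simp add: S_def)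
  have b: "0 \<le> b" "b \<le> R"
    unfolding b_def by (rule cSup_upper[OF \<open>0 \<in> S\<close> bdd], rule cSup_least, use \<open>0 \<in> S\<close> in blast, rule S_le)
  \<comment> \<open>The bound \<open>B\<close> on all partial sums passes to the limit point
    \<open>b\<close>, so the series still converges at the supremum.\<close>
  have "b \<in> closure S"
    unfolding b_def by (rule closure_contains_Sup[OF _ bdd]) (use \<open>0 \<in> S\<close> in blast)
  have "(\<Sum>n<N. partition_sum v y n * b ^ n) \<le> B" for N
  proof -
    have "closed {z. (\<Sum>n<N. partition_sum v y n * z ^ n) \<le> B}"
      by (intro closed_Collect_le continuous_intros)
    then have "closure S \<subseteq> {z. (\<Sum>n<N. partition_sum v y n * z ^ n) \<le> B}"
      using partial by (intro closure_minimal) auto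
    then show ?thesis using \<open>b \<in> closure S\<close> by auto
  qed
  then have summable_b: "summable (\<lambda>n. partition_sum v y n * b ^ n)"
    using partition_sum_nonneg[OF y] b by (intro summableI_nonneg_bounded) auto
  have "b = R"
  proof (rule ccontr)
    assume "b \<noteq> R"
    \<comment> \<open>Some term at \<open>b\<close> is below 1 and stays so slightly to the right of
      \<open>b\<close>; submultiplicativity then gives convergence beyond the supremum.\<close>
    have "(\<lambda>n. partition_sum v y n * b ^ n) \<longlonglongrightarrow> 0" by (rule summable_LIMSEQ_zero[OF summable_b])
    then have "eventually (\<lambda>n. partition_sum v y n * b ^ n < 1 \<and> n \<ge> 1) sequentially"
      by (intro eventually_conj order_tendstoD eventually_ge_at_top) auto
    then obtain N where N: "partition_sum v y N * b ^ N < 1" "N \<ge> 1"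
      using eventually_happens'[OF sequentially_bot] by blast
    have "((\<lambda>z. partition_sum v y N * z ^ N) \<longlongrightarrow> partition_sum v y N * b ^ N) (at_right b)"
      by (intro tendsto_intros)
    then have "eventually (\<lambda>z. partition_sum v y N * z ^ N < 1) (at_right b)"
      using N by (intro order_tendstoD)
    moreover have "eventually (\<lambda>z. z \<in> {b<..R}) (at_right b)"
      by (rule eventually_at_rightI[of _ R]) (use b \<open>b \<noteq> R\<close> in auto)
    ultimately have "eventually (\<lambda>z. partition_sum v y N * z ^ N < 1 \<and> z \<in> {b<..R}) (at_right b)"
      by (rule eventually_conj)
    then obtain z where z: "partition_sum v y N * z ^ N < 1" "b < z" "z \<le> R"
      using eventually_happens'[OF trivial_limit_at_right_real] by fastforce
    then have "z \<in> S"
      using partition_sum_summable_if_lt_1[OF y _ N(2) z(1)] b by (auto simp: S_def)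
    then have "z \<le> b" unfolding b_def using bdd by (rule cSup_upper)
    with z show False by simp
  qed
  then show ?thesis using summable_b by simp
qed

text \<open>A term below 1 would make the series converge, and its value times
  \<open>denom v r y = 0\<close> would equal \<open>corr v r y\<close>, which is at least 1.\<close>

lemma partition_sum_ge_at_root:
  assumes "v \<noteq> []" "y \<ge> 0" "r \<ge> 0" "denom v r y = 0" "n \<ge> 1"
  shows "partition_sum v y n * r ^ n \<ge> 1"
proof (rule ccontr)
  assume "\<not> 1 \<le> partition_sum v y n * r ^ n"
  then have "summable (\<lambda>n. partition_sum v y n * r ^ n)"
    using partition_sum_summable_if_lt_1[of y r n v] assms by auto
  then have "corr v r y = 0"
    using partition_sum_suminf_denom[of v r y] assms by simp
  then show False using corr_ge_1[of v r y] assms by simp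
qed

section \<open>Mean number of ones and growth rates\<close>

lemma partition_sum_exp_ge:
  assumes "partition_sum v 1 n > 0" "n \<ge> 1"
  shows "partition_sum v (exp t) n \<ge> partition_sum v 1 n * exp (t * (real n * rho_n v n))"
proof -
  define M where "M = real n * rho_n v n"
  have N: "partition_sum v 1 n = real (card (Omega_n v n))" by (simp add: partition_sum_def)
  have M: "M * partition_sum v 1 n = (\<Sum>\<omega>\<in>Omega_n v n. real (ones \<omega>))"
    using assms unfolding M_def rho_n_def N by simp
  have "partition_sum v 1 n * exp (t * M) = exp (t * M) * (\<Sum>\<omega>\<in>Omega_n v n. 1 + t * (real (ones \<omega>) - M))"
    by (simp add: sum.distrib sum_distrib_left[symmetric] sum_subtractf M[symmetric] N)
  \<comment> \<open>\<open>1 + x \<le> exp x\<close> is applied at the deviations from the mean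
    \<open>M\<close>, whose linear terms sum to 0.\<close>
  also have "\<dots> \<le> exp (t * M) * (\<Sum>\<omega>\<in>Omega_n v n. exp (t * (real (ones \<omega>) - M)))"
    by (intro mult_left_mono sum_mono) auto
  also have "\<dots> = partition_sum v (exp t) n"
    by (simp add: partition_sum_def sum_distrib_left exp_add[symmetric] exp_of_nat_mult[symmetric] algebra_simps)
  finally show ?thesis by (simp add: M_def)
qed

text \<open>Comparing Jensen's inequality with the growth rates \<open>1/r\<close> and \<open>exp a / r\<close> of \<open>partition_sum v 1\<close> and
  \<open>partition_sum v (exp t)\<close> bounds the mean number of ones.\<close>

lemma rho_n_bound:
  assumes v: "v \<noteq> []" and r: "r > 0" "denom v r 1 = 0"
    and pos: "\<And>x. 0 \<le> x \<Longrightarrow> x \<le> r \<Longrightarrow> denom v (x * exp (- a)) (exp t) > 0"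
  shows "\<exists>B. \<forall>n\<ge>1. t * rho_n v n \<le> a + B / real n"
proof -
  define R where "R = r * exp (- a)"
  have R: "R > 0" using r by (simp add: R_def)
  have "denom v z (exp t) > 0" if "0 \<le> z" "z \<le> R" for z
    using pos[of "z * exp a"] that by (simp add: R_def exp_minus field_simps)
  then have "summable (\<lambda>n. partition_sum v (exp t) n * R ^ n)"
    by (intro partition_sum_summable_if_denom_pos v) (use R in auto)
  then have "Bseq (\<lambda>n. partition_sum v (exp t) n * R ^ n)"
    by (intro convergent_imp_Bseq) (auto simp: convergent_def dest: summable_LIMSEQ_zero)
  then obtain B where B: "B > 0" "\<And>n. norm (partition_sum v (exp t) n * R ^ n) \<le> B"
    by (auto simp: Bseq_def)
  have "t * rho_n v n \<le> a + ln B / real n" if n: "n \<ge> 1" for n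
  proof -
    have Z1: "partition_sum v 1 n * r ^ n \<ge> 1" using partition_sum_ge_at_root[OF v _ _ r(2) n] r by simp
    then have "partition_sum v 1 n > 0" using r by (smt (verit, best) mult_nonpos_nonneg zero_less_power)
    then have "partition_sum v 1 n * exp (t * (real n * rho_n v n)) * R ^ n \<le> partition_sum v (exp t) n * R ^ n"
      using R n by (intro mult_right_mono partition_sum_exp_ge) auto
    also have "\<dots> \<le> B" using B(2)[of n] by simp
    also have "R ^ n = r ^ n * exp (- (real n * a))"
      by (simp add: R_def power_mult_distrib exp_of_nat_mult[symmetric])
    finally have "partition_sum v 1 n * r ^ n * exp (t * (real n * rho_n v n) - real n * a) \<le> B"
      by (simp add: exp_diff exp_minus field_simps)
    moreover have "1 * exp (t * (real n * rho_n v n) - real n * a) \<le>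
      partition_sum v 1 n * r ^ n * exp (t * (real n * rho_n v n) - real n * a)"
      using Z1 by (intro mult_right_mono) auto
    ultimately have "exp (t * (real n * rho_n v n) - real n * a) \<le> B" by linarith
    then have "t * (real n * rho_n v n) - real n * a \<le> ln B"
      using B(1) ln_ge_iff by blast
    then show ?thesis using n by (simp add: field_simps)
  qed
  then show ?thesis by blast
qed

text \<open>Only the end point \<open>r\<close> is delicate, as \<open>G r 0\<close> may vanish:
  near it the positive derivative in \<open>h\<close> makes \<open>G\<close> grow from a
  non-negative value. On the rest of the segment the tube lemma gives a uniform range of
  \<open>h\<close>.\<close>

lemma ex_pos_on_segment:
  fixes G G' :: "real \<Rightarrow> real \<Rightarrow> real"
  assumes r: "r > 0"
    and deriv: "\<And>x h. (G x has_real_derivative G' x h) (at h)"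
    and contG: "continuous_on UNIV (\<lambda>p. G (snd p) (fst p))"
    and contG': "continuous_on UNIV (\<lambda>p. G' (snd p) (fst p))"
    and pos: "\<And>x. 0 \<le> x \<Longrightarrow> x < r \<Longrightarrow> G x 0 > 0"
    and at_end: "G r 0 \<ge> 0" "G' r 0 > 0"
  shows "\<exists>h>0. \<forall>x\<in>{0..r}. G x h > 0"
proof -
  let ?W' = "{p. 0 < G' (snd p) (fst p)}" and ?W = "{p. 0 < G (snd p) (fst p)}"
  have "open ?W'" using contG' by (intro open_Collect_less) auto
  moreover have "(0, r) \<in> ?W'" using at_end by simp
  ultimately obtain A B where AB: "open A" "open B" "0 \<in> A" "r \<in> B" "A \<times> B \<subseteq> ?W'"
    by (rule open_prod_elim) auto
  obtain e where e: "e > 0" "ball 0 e \<subseteq> A" using AB by (meson openE)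
  obtain d where d: "d > 0" "ball r d \<subseteq> B" using AB by (meson openE)
  have G': "G' x h > 0" if "\<bar>h\<bar> < e" "\<bar>x - r\<bar> < d" for x h
  proof -
    have "h \<in> A" "x \<in> B" using that e d by (auto simp: dist_real_def abs_minus_commute)
    then show ?thesis using AB(5) by auto
  qed
  have "open ?W" using contG by (intro open_Collect_less) auto
  moreover have "{0} \<times> {0..r - d / 2} \<subseteq> ?W" using pos d by auto
  ultimately have "\<exists>X. 0 \<in> X \<and> open X \<and> X \<times> {0..r - d / 2} \<subseteq> ?W"
    by (rule Elementary_Topology.tube_lemma[OF compact_Icc])
  then obtain X where X: "0 \<in> X" "open X" "X \<times> {0..r - d / 2} \<subseteq> ?W" by blast
  obtain f where f: "f > 0" "ball 0 f \<subseteq> X" using X by (meson openE)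
  define h where "h = min e f / 2"
  have h: "0 < h" "h < e" "h < f" using e f by (auto simp: h_def)
  have "G x h > 0" if x: "x \<in> {0..r}" for x
  proof (cases "x \<le> r - d / 2")
    case True
    have "h \<in> X" using f h by (auto simp: dist_real_def)
    then have "(h, x) \<in> X \<times> {0..r - d / 2}" using x True by auto
    then have "(h, x) \<in> ?W" using X(3) by blast
    then show ?thesis by simp
  next
    case False
    have "G x 0 < G x h"
    proof (rule DERIV_pos_imp_increasing[OF h(1)])
      fix t assume "0 \<le> t" "t \<le> h"
      then have "G' x t > 0" using h x False d by (intro G') auto
      then show "\<exists>y. (G x has_real_derivative y) (at t) \<and> 0 < y" using deriv by blast
    qed
    moreover have "G x 0 \<ge> 0" using pos[of x] at_end x by (cases "x = r") auto
    ultimately show ?thesis by linarith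
  qed
  then show ?thesis using h by blast
qed

text \<open>The negative derivative makes the zero simple; \<open>r > 1 / 2\<close> is recorded
  because the sign of \<open>2 * r - 1\<close> decides the comparison of frequencies.\<close>

definition simple_root :: "bool list \<Rightarrow> real \<Rightarrow> bool" where
  "simple_root v r \<longleftrightarrow> r > 1 / 2 \<and> denom v r 1 = 0 \<and> denom_dz v r 1 < 0 \<and>
     (\<forall>z. 0 \<le> z \<longrightarrow> z < r \<longrightarrow> denom v z 1 > 0)"

text \<open>At \<open>h = 0\<close> and \<open>x = r\<close> the derivative in \<open>h\<close> is
  \<open>\<sigma> * denom_dy v r 1 - a * r * denom_dz v r 1\<close>, which the assumption makes
  positive.\<close>

lemma ex_denom_pos_tilted:
  assumes "simple_root v r" and a: "a * r * denom_dz v r 1 < \<sigma> * denom_dy v r 1"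
  shows "\<exists>h>0. \<forall>x\<in>{0..r}. denom v (x * exp (- (a * h))) (exp (\<sigma> * h)) > 0"
proof -
  let ?G' = "\<lambda>x h. denom_dz v (x * exp (- (a * h))) (exp (\<sigma> * h)) * (- (a * x * exp (- (a * h)))) +
    denom_dy v (x * exp (- (a * h))) (exp (\<sigma> * h)) * (\<sigma> * exp (\<sigma> * h))"
  show ?thesis
  proof (rule ex_pos_on_segment[where G' = ?G'])
    show "((\<lambda>h. denom v (x * exp (- (a * h))) (exp (\<sigma> * h))) has_real_derivative ?G' x h) (at h)" for x h
      by (rule DERIV_denom) (auto intro!: derivative_eq_intros)
    show "0 < ?G' r 0" using a by (simp add: algebra_simps)
  qed (use assms(1) in \<open>auto simp: simple_root_def intro!: continuous_intros\<close>)
qed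

text \<open>The sign \<open>\<sigma>\<close> treats the upper and the lower estimate of
  \<open>rho_n\<close> at once.\<close>

lemma rho_n_upper:
  assumes v: "v \<noteq> []" and root: "simple_root v r" and \<sigma>: "\<sigma> = 1 \<or> \<sigma> = - 1" and "\<epsilon> > 0"
  defines "s \<equiv> denom_dy v r 1 / (r * denom_dz v r 1)"
  shows "eventually (\<lambda>n. \<sigma> * rho_n v n < \<sigma> * s + \<epsilon>) sequentially"
proof -
  have r: "r > 0" "denom v r 1 = 0" "denom_dz v r 1 < 0" using root by (auto simp: simple_root_def)
  \<comment> \<open>The surplus \<open>\<epsilon> / 2\<close> over \<open>\<sigma> * s\<close> makes
    the tilting condition strict because \<open>denom_dz v r 1 < 0\<close>.\<close>
  define a where "a = \<sigma> * s + \<epsilon> / 2"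
  have "a * r * denom_dz v r 1 = \<sigma> * denom_dy v r 1 + \<epsilon> / 2 * r * denom_dz v r 1"
    using r by (simp add: a_def s_def field_simps)
  also have "\<dots> < \<sigma> * denom_dy v r 1"
    using r \<open>\<epsilon> > 0\<close> by (simp add: mult_pos_neg)
  finally obtain h where h: "h > 0" "\<forall>x\<in>{0..r}. denom v (x * exp (- (a * h))) (exp (\<sigma> * h)) > 0"
    using ex_denom_pos_tilted[OF root] by blast
  then obtain B where B: "\<And>n. n \<ge> 1 \<Longrightarrow> \<sigma> * h * rho_n v n \<le> a * h + B / real n"
    using rho_n_bound[OF v r(1,2), of "a * h" "\<sigma> * h"] by auto
  have "(\<lambda>n. B / h / real n) \<longlonglongrightarrow> 0"
    by (rule lim_const_over_n)
  then have "eventually (\<lambda>n. B / h / real n < \<epsilon> / 2) sequentially"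
    using \<open>\<epsilon> > 0\<close> by (intro order_tendstoD) auto
  then show ?thesis
    using eventually_ge_at_top[of 1]
  proof eventually_elim
    case (elim n)
    have "h * (\<sigma> * rho_n v n) \<le> h * (a + B / h / real n)"
      using B[OF elim(2)] h by (simp add: field_simps)
    then have "\<sigma> * rho_n v n \<le> a + B / h / real n"
      using h by (simp only: mult_le_cancel_left_pos)
    then show ?case using elim(1) unfolding a_def by linarith
  qed
qed

lemma rho_eq:
  assumes "v \<noteq> []" "simple_root v r"
  shows "rho v = denom_dy v r 1 / (r * denom_dz v r 1)"
proof -
  let ?s = "denom_dy v r 1 / (r * denom_dz v r 1)"
  have "rho_n v \<longlonglongrightarrow> ?s"
  proof (rule tendstoI)
    fix \<epsilon> :: real assume "\<epsilon> > 0"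
    then show "eventually (\<lambda>n. dist (rho_n v n) ?s < \<epsilon>) sequentially"
      using rho_n_upper[OF assms _ \<open>\<epsilon> > 0\<close>, of 1] rho_n_upper[OF assms _ \<open>\<epsilon> > 0\<close>, of "- 1"]
      by (auto simp: dist_real_def elim: eventually_elim2)
  qed
  then show ?thesis unfolding rho_def by (rule limI)
qed

section \<open>Existence of a simple root\<close>

lemma simple_rootI:
  assumes v: "v \<noteq> []" and z0: "1 / 2 \<le> z0" "denom v z0 1 \<le> 0"
    and dz: "\<And>z. 1 / 2 \<le> z \<Longrightarrow> z \<le> z0 \<Longrightarrow> denom_dz v z 1 < 0"
  shows "\<exists>r. simple_root v r"
proof -
  \<comment> \<open>Up to \<open>1 / 2\<close> both summands of \<open>denom\<close> are
    non-negative and at least one is positive.\<close>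
  have small: "denom v z 1 > 0" if "0 \<le> z" "z \<le> 1 / 2" for z
  proof (cases "z = 0")
    case True
    then show ?thesis using corr_ge_1[OF v, of 0 1] v by (simp add: denom_def add_nonneg_pos)
  next
    case False
    then show ?thesis
      using that corr_ge_1[OF v, of z 1] by (auto simp: denom_def intro!: add_pos_nonneg)
  qed
  have deriv: "((\<lambda>z. denom v z 1) has_real_derivative denom_dz v z 1) (at z)" for z
    using DERIV_denom[OF DERIV_ident DERIV_const[of 1], where v = v and h = z] by simp
  have "\<exists>r\<ge>1 / 2. r \<le> z0 \<and> denom v r 1 = 0"
    using z0 small[of "1 / 2"] by (intro IVT2') (auto intro!: continuous_intros)
  then obtain r where r: "1 / 2 \<le> r" "r \<le> z0" "denom v r 1 = 0" by blast
  have "r \<noteq> 1 / 2"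
  proof
    assume "r = 1 / 2"
    then have "denom v (1 / 2) 1 = 0" using r(3) by blast
    then show False using small[of "1 / 2"] by simp
  qed
  \<comment> \<open>Beyond \<open>1 / 2\<close>, strict decrease up to \<open>r\<close> excludes an
    earlier zero.\<close>
  have "denom v z 1 > 0" if "0 \<le> z" "z < r" for z
  proof (cases "z \<le> 1 / 2")
    case False
    have "denom v r 1 < denom v z 1"
    proof (rule DERIV_neg_imp_decreasing[OF \<open>z < r\<close>])
      fix x assume "z \<le> x" "x \<le> r"
      then show "\<exists>y. ((\<lambda>z. denom v z 1) has_real_derivative y) (at x) \<and> y < 0"
        using dz[of x] deriv[of x] False r by (intro exI[of _ "denom_dz v x 1"]) auto
    qed
    then show ?thesis using r by simp
  qed (use small that in auto)
  then show ?thesis using r dz[of r] \<open>r \<noteq> 1 / 2\<close> by (auto simp: simple_root_def intro!: exI[of _ r])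
qed

text \<open>Passing from \<open>n\<close> to \<open>n + 1\<close> multiplies by
  \<open>3 (n + 1) / (4 n)\<close>, which is at most 1 for \<open>n \<ge> 3\<close>.\<close>

lemma three_quarters_bound: "n \<ge> 3 \<Longrightarrow> real n * (3 / 4) ^ (n - 1) < 2"
proof (induction n rule: dec_induct)
  case base
  show ?case by (simp add: power2_eq_square)
next
  case (step n)
  then obtain k where k: "n = Suc k" by (cases n) auto
  have "real (Suc n) * (3 / 4) ^ (Suc n - 1) = (3 / 4 * real (Suc n)) * (3 / 4) ^ (n - 1)"
    by (simp add: k)
  also have "\<dots> \<le> real n * (3 / 4) ^ (n - 1)"
    using step.hyps by (intro mult_right_mono) auto
  finally show ?case using step.IH by linarith
qed

text \<open>Length 2 must be excluded: for \<open>[True, False]\<close> the denominator is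
  \<open>(1 - z)^2\<close>, with a double zero. For length at least 3 it is negative at
  \<open>3 / 4\<close> and decreasing on the way there; for length 1 it is
  \<open>1 - z\<close>.\<close>

lemma ex_simple_root:
  assumes "v \<noteq> []" "length v \<noteq> 2"
  shows "\<exists>r. simple_root v r"
proof (cases "length v = 1")
  case True
  then obtain b where v: "v = [b]" by (auto simp: length_Suc_conv)
  then have "borders v v = {v}" by (auto simp: borders_def prefix_Cons)
  then have "corr v z 1 = 1" "corr_dz v z 1 = 0" for z by (simp_all add: corr_def corr_dz_def)
  then show ?thesis using assms True by (intro simple_rootI[of v 1]) (simp_all add: denom_def denom_dz_def)
next
  case False
  then have n: "length v \<ge> 3" using assms by (cases "length v" rule: nat.exhaust) auto
  show ?thesis
  proof (rule simple_rootI[of v "3 / 4"])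
    have "(3 / 4) ^ length v \<le> (3 / 4 :: real) ^ 3" using n by (intro power_decreasing) auto
    also have "\<dots> < 1 / 2" by (simp add: power3_eq_cube)
    finally show "denom v (3 / 4) 1 \<le> 0"
      using corr_ge_1[OF assms(1), of "3 / 4" 1] by (simp add: denom_def)
  next
    fix z :: real assume z: "1 / 2 \<le> z" "z \<le> 3 / 4"
    have "real (length v) * z ^ (length v - 1) \<le> real (length v) * (3 / 4) ^ (length v - 1)"
      using z by (intro mult_left_mono power_mono) auto
    also have "\<dots> < 2" by (rule three_quarters_bound[OF n])
    finally have "real (length v) * z ^ (length v - 1) < 2" .
    moreover have "corr_dz v z 1 \<ge> 0"
      using z by (auto simp: corr_dz_def intro!: sum_nonneg)
    then have "(1 - z * 2) * corr_dz v z 1 \<le> 0" using z by (intro mult_nonpos_nonneg) auto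
    ultimately show "denom_dz v z 1 < 0"
      using corr_ge_1[OF assms(1), of z 1] z by (simp add: denom_dz_def)
  qed (use assms in auto)
qed

section \<open>Comparison of \<open>v\<close> and \<open>w\<close> at \<open>y = 1\<close>\<close>

context
  fixes v w :: "bool list"
  assumes ne: "v \<noteq> []" "w \<noteq> []" and len: "length v = length w" and ge: "ones v \<ge> ones w"
    and borders_eq: "borders v v - {v} = borders w w - {w}"
begin

lemma borders_self_eq_insert: "borders v v = insert v (borders w w - {w})" "borders w w = insert w (borders w w - {w})"
    "v \<notin> borders w w - {w}"
  using ne borders_eq by (auto simp: borders_def)

lemma corr_at_1_eq: "corr v z 1 = corr w z 1" "corr_dz v z 1 = corr_dz w z 1"
proof -
  let ?B = "borders w w - {w}"
  have "corr v z 1 = 1 + (\<Sum>u\<in>?B. z ^ (length w - length u))" "corr w z 1 = 1 + (\<Sum>u\<in>?B. z ^ (length w - length u))"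
    unfolding corr_def using borders_self_eq_insert(3)
    by (subst borders_self_eq_insert, subst sum.insert, auto simp: len)+
  then show "corr v z 1 = corr w z 1" by simp
  have "corr_dz v z 1 = (\<Sum>u\<in>?B. real (length w - length u) * z ^ (length w - length u - 1))"
    "corr_dz w z 1 = (\<Sum>u\<in>?B. real (length w - length u) * z ^ (length w - length u - 1))"
    unfolding corr_dz_def using borders_self_eq_insert(3)
    by (subst borders_self_eq_insert, subst sum.insert, auto simp: len)+
  then show "corr_dz v z 1 = corr_dz w z 1" by simp
qed

text \<open>Each proper border leaves \<open>ones v - ones w\<close> more ones outside it in
  \<open>v\<close> than in \<open>w\<close>, and \<open>corr w z 1 - 1\<close> sums over the proper
  borders.\<close>

lemma corr_dy_at_1_diff:
  "corr_dy v z 1 - corr_dy w z 1 = (real (ones v) - real (ones w)) * (corr w z 1 - 1)"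
proof -
  let ?B = "borders w w - {w}"
  let ?S = "\<lambda>x. \<Sum>u\<in>?B. z ^ (length w - length u) * real (ones x - ones u)"
  have S: "corr_dy v z 1 = ?S v" "corr_dy w z 1 = ?S w" "corr w z 1 = 1 + (\<Sum>u\<in>?B. z ^ (length w - length u))"
    unfolding corr_dy_def corr_def using borders_self_eq_insert(3)
    by (subst borders_self_eq_insert, subst sum.insert, auto simp: len)+
  have "z ^ (length w - length u) * real (ones v - ones u) - z ^ (length w - length u) * real (ones w - ones u) =
      (real (ones v) - real (ones w)) * z ^ (length w - length u)" if "u \<in> ?B" for u
  proof -
    have "suffix u w" using that by (auto simp: borders_def)
    then have "ones u \<le> ones w" by (auto simp: suffix_def)
    then show ?thesis using ge by (simp add: of_nat_diff algebra_simps)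
  qed
  then show ?thesis unfolding S by (simp add: sum_subtractf[symmetric] sum_distrib_left)
qed

lemma simple_root_transfer: "simple_root v r \<Longrightarrow> simple_root w r"
  by (simp add: simple_root_def denom_def denom_dz_def corr_at_1_eq len)

text \<open>Both frequencies have the same negative denominator \<open>r * denom_dz v r 1\<close>,
  so the larger derivative in \<open>y\<close> yields the smaller frequency.\<close>

lemma rho_less:
  assumes less: "ones w < ones v" and "simple_root v r"
  shows "rho v < rho w"
proof -
  have r: "r > 1 / 2" "denom v r 1 = 0" "denom_dz v r 1 < 0" using assms(2) by (auto simp: simple_root_def)
  have dz: "denom_dz w r 1 = denom_dz v r 1" by (simp add: denom_dz_def corr_at_1_eq len)
  have "denom_dy v r 1 - denom_dy w r 1 =
    (real (ones v) - real (ones w)) * r ^ length w + (1 - r * 2) * (corr_dy v r 1 - corr_dy w r 1)"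
    by (simp add: denom_dy_def corr_at_1_eq len algebra_simps)
  \<comment> \<open>Regrouped so that \<open>r ^ length w + (1 - r * 2) * corr w r 1\<close> appears
    as \<open>denom v r 1\<close>, which is 0.\<close>
  also have "\<dots> = (real (ones v) - real (ones w)) * (denom v r 1 - (1 - r * 2))"
    unfolding corr_dy_at_1_diff by (simp add: denom_def corr_at_1_eq len algebra_simps)
  finally have "denom_dy v r 1 - denom_dy w r 1 = (real (ones v) - real (ones w)) * (2 * r - 1)"
    using r by simp
  also have "\<dots> > 0" using less r by simp
  finally have "denom_dy w r 1 < denom_dy v r 1" by simp
  then show ?thesis
    unfolding rho_eq[OF ne(1) assms(2)] rho_eq[OF ne(2) simple_root_transfer[OF assms(2)]] dz
    using r by (intro divide_strict_right_mono_neg) (auto intro: mult_pos_neg)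
qed

end

text \<open>The proper borders tell whether a two-letter word is constant and with which letter, so
  two different words must be \<open>[True, False]\<close> and \<open>[False, True]\<close>. This
  settles the length that \<open>ex_simple_root\<close> leaves out.\<close>

lemma ones_eq_if_length_2:
  assumes "v \<noteq> w" "length v = length w" "length v = 2" "borders v v - {v} = borders w w - {w}"
  shows "ones v = ones w"
proof -
  obtain a b c d where vw: "v = [a, b]" "w = [c, d]"
  proof -
    have "length v = Suc (Suc 0)" "length w = Suc (Suc 0)" using assms(2,3) by simp_all
    then show ?thesis using that unfolding length_Suc_conv by auto
  qed
  have border: "[x] \<in> borders [y, z] [y, z] - {[y, z]} \<longleftrightarrow> x = y \<and> x = z" for x y z
    by (auto simp: borders_def suffix_Cons)
  have "x = a \<and> x = b \<longleftrightarrow> x = c \<and> x = d" for x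
    using assms(4) border[of x a b] border[of x c d] unfolding vw by simp
  then show ?thesis using assms(1) unfolding vw by (cases a; cases b; cases c; cases d) auto
qed

theorem theorem3p6:
  fixes v w :: "bool list"
  assumes "v \<noteq> []" and "w \<noteq> []"
    and "v \<noteq> w"
    and "length v = length w"
    and "ones v \<ge> ones w"
    and "borders v v - {v} = borders w w - {w}"
  shows "(\<exists>\<kappa>. length_preserving w v \<kappa> \<and> bij_betw \<kappa> (Omega w) (Omega v) \<and>
            (\<forall>\<omega>\<in>Omega w. ones \<omega> \<ge> ones (\<kappa> \<omega>))) \<and>
         (borders v v - {v} = borders w w - {w} \<and> borders w w - {w} = borders v w \<and>
            borders v w = borders w v \<longrightarrow>
          (\<exists>\<psi>. length_preserving w v \<psi> \<and> bij_betw \<psi> (Omega w) (Omega v) \<and>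
            (\<forall>\<omega>\<in>Omega w. ones \<omega> \<ge> ones (\<psi> \<omega>)) \<and> bounded_coding_radius w \<psi>)) \<and>
         rho v \<le> rho w \<and>
         (ones v > ones w \<longrightarrow> rho v < rho w)"
proof (intro conjI impI)
  note hyps = assms(1,2,4,5,6)
  show "\<exists>\<kappa>. length_preserving w v \<kappa> \<and> bij_betw \<kappa> (Omega w) (Omega v) \<and>
          (\<forall>\<omega>\<in>Omega w. ones \<omega> \<ge> ones (\<kappa> \<omega>))"
    by (rule ex_ones_decreasing_bij[OF hyps])
  have less: "rho v < rho w" if "ones v > ones w"
  proof -
    have "length v \<noteq> 2" using ones_eq_if_length_2[OF assms(3,4) _ assms(6)] that by auto
    then show ?thesis using ex_simple_root[OF assms(1)] rho_less[OF hyps that] by blast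
  qed
  then show "rho v < rho w" if "ones v > ones w" using that .
  show "rho v \<le> rho w"
    using less rho_eq_if_ones_eq[OF assms(1,2,4) _ assms(6)] assms(5) by (cases "ones v = ones w") auto
  assume *: "borders v v - {v} = borders w w - {w} \<and> borders w w - {w} = borders v w \<and>
    borders v w = borders w v"
  \<comment> \<open>The exchange goes from \<open>v\<close> to \<open>w\<close>: a word avoiding
    \<open>w\<close> loses all its occurrences of \<open>v\<close>.\<close>
  let ?\<psi> = "replace_all v w"
  have "length_preserving w v ?\<psi>" "bij_betw ?\<psi> (Omega w) (Omega v)"
    using bij_betw_Omega[of "\<lambda>_. ?\<psi>" w v] bij_betw_replace_all[OF assms(4) _ _ _ assms(3)] * by blast+
  moreover have "\<forall>\<omega>\<in>Omega w. ones \<omega> \<ge> ones (?\<psi> \<omega>)"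
    using ones_replace_all[OF assms(4) _ _ _ assms(5)] * by blast
  ultimately show "\<exists>\<psi>. length_preserving w v \<psi> \<and> bij_betw \<psi> (Omega w) (Omega v) \<and>
      (\<forall>\<omega>\<in>Omega w. ones \<omega> \<ge> ones (\<psi> \<omega>)) \<and> bounded_coding_radius w \<psi>"
    using bounded_coding_radius_replace_all by blast
qed

end
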